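(* Let $\Phi$ be an irreducible finite root system and $m$ a nonnegative integer. The compatibility relation on the set $\Phi^m_{\ge -1}$ of colored almost positive roots has the following properties: (i) $\alpha^k$ is compatible with $\beta^l$ if and only if $R_m(\alpha^k)$ is compatible with $R_m(\beta^l)$; (ii) $(-\alpha_i)^1$ is compatible with $\beta^l$ if and only if the simple root expansion of $\beta$ does not involve $\alpha_i$. Furthermore, conditions (i)–(ii) uniquely determine this relation.
   Context: $\Phi$ is an irreducible finite (not necessarily crystallographic) root system of rank $n$ with positive roots $\Phi_{>0}$, simple roots $\{\alpha_i: i\in I\}$, $|I|=n$, and corresponding simple reflections $s_i$. The set of almost positive roots is $\Phi_{\ge -1}=\Phi_{>0}\cup\{-\alpha_i:i\in I\}$. Fix a decomposition $I=I_+\cup I_-$ into disjoint sets, each of which labels a totally disconnected set of vertices of the Coxeter diagram of $\Phi$. For $\varepsilon\in\{+,-\}$ define the involution $\tau_\varepsilon:\Phi_{\ge-1}\to\Phi_{\ge-1}$ by $\tau_\varepsilon(\alpha)=\alpha$ if $\alpha=-\alpha_i$ with $i\in I_{-\varepsilon}$, and $\tau_\varepsilon(\alpha)=\bigl(\prod_{i\in I_\varepsilon}s_i\bigr)(\alpha)$ otherwise. Put $R=\tau_-\tau_+$. Non-colored compatibility on $\Phi_{\ge-1}$ is the (known to exist) unique symmetric binary relation such that: $\alpha$ and $\beta$ are compatible if and only if $R(\alpha)$ and $R(\beta)$ are compatible; a negative simple root $-\alpha_i$ is compatible with a positive root $\beta$ if and only if the simple root expansion of $\beta$ does not involve $\alpha_i$.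 For $\beta\in\Phi_{\ge-1}$ let $d(\beta)$ be the smallest $d\ge 0$ such that $R^d(\beta)$ is a negative root. Let $m$ be a nonnegative integer. The set of colored almost positive roots is $\Phi^m_{\ge-1}=\{\alpha^k:\alpha\in\Phi_{>0},\,k\in\{1,\dots,m\}\}\cup\{(-\alpha_i)^1:i\in I\}$, i.e. $m$ colored copies of each positive root and one copy (of color 1) of each negative simple root. Two colored roots $\alpha^k,\beta^l\in\Phi^m_{\ge-1}$ are called compatible if and only if one of the following holds (on the right, compatibility is in the non-colored sense): - $k>l$, $d(\alpha)\le d(\beta)$, and $R(\alpha)$ and $\beta$ are compatible; - $k<l$, $d(\alpha)\ge d(\beta)$, and $\alpha$ and $R(\beta)$ are compatible; - $k>l$, $d(\alpha)>d(\beta)$, and $\alpha$ and $\beta$ are compatible; - $k<l$, $d(\alpha)<d(\beta)$, and $\alpha$ and $\beta$ are compatible; - $k=l$, and $\alpha$ and $\beta$ are compatible. For $\alpha^k\in\Phi^m_{\ge-1}$, set $R_m(\alpha^k)=\alpha^{k+1}$ if $\alpha\in\Phi_{>0}$ and $k<m$, and $R_m(\alpha^k)=(R(\alpha))^1$ otherwise.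
   Formalization: The two rules for non-colored compatibility leave pairs of negative simple roots undetermined (e.g. in A_1); the formal definition adds that distinct negative simple roots are compatible and none is compatible with itself, the only choice for which (ii) holds for all colored roots. *)

theory Defs
  imports "HOL-Analysis.Analysis"
begin

definition refl_root :: "'a::euclidean_space \<Rightarrow> 'a \<Rightarrow> 'a" where
  "refl_root a v = v - (2 * (v \<bullet> a) / (a \<bullet> a)) *\<^sub>R a"

text \<open>
  Root systems need not be crystallographic. The roots are not required to span the
  ambient space; the rank is the dimension of their span.
\<close>

definition root_system :: "'a::euclidean_space set \<Rightarrow> bool" where
  "root_system \<Phi> \<longleftrightarrow>
     finite \<Phi> \<and> 0 \<notin> \<Phi> \<and>
     (\<forall>a\<in>\<Phi>. refl_root a ` \<Phi> = \<Phi>) \<and>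
     (\<forall>a\<in>\<Phi>. \<Phi> \<inter> range (\<lambda>c. c *\<^sub>R a) = {a, - a})"

definition irreducible_roots :: "'a::euclidean_space set \<Rightarrow> bool" where
  "irreducible_roots \<Phi> \<longleftrightarrow>
     \<Phi> \<noteq> {} \<and>
     \<not> (\<exists>A B. A \<noteq> {} \<and> B \<noteq> {} \<and> A \<inter> B = {} \<and> A \<union> B = \<Phi> \<and> (\<forall>a\<in>A. \<forall>b\<in>B. a \<bullet> b = 0))"

text \<open>
  The simple roots index themselves: a set \<open>\<Delta>\<close> of simple roots also plays the role of the
  index set \<open>I\<close>. The coefficient of \<open>a \<in> \<Delta>\<close> in the simple root expansion of \<open>v\<close>
  is \<open>representation \<Delta> v a\<close>.
\<close>

definition simple_system :: "'a::euclidean_space set \<Rightarrow> 'a set \<Rightarrow> bool" where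
  "simple_system \<Phi> \<Delta> \<longleftrightarrow>
     \<Delta> \<subseteq> \<Phi> \<and> independent \<Delta> \<and> \<Phi> \<subseteq> span \<Delta> \<and>
     (\<forall>b\<in>\<Phi>. (\<forall>a\<in>\<Delta>. 0 \<le> representation \<Delta> b a) \<or> (\<forall>a\<in>\<Delta>. representation \<Delta> b a \<le> 0))"

definition positive_roots :: "'a::euclidean_space set \<Rightarrow> 'a set \<Rightarrow> 'a set" where
  "positive_roots \<Phi> \<Delta> = {b \<in> \<Phi>. \<forall>a\<in>\<Delta>. 0 \<le> representation \<Delta> b a}"

definition almost_positive_roots :: "'a::euclidean_space set \<Rightarrow> 'a set \<Rightarrow> 'a set" where
  "almost_positive_roots \<Phi> \<Delta> = positive_roots \<Phi> \<Delta> \<union> uminus ` \<Delta>"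

definition involves :: "'a::euclidean_space set \<Rightarrow> 'a \<Rightarrow> 'a \<Rightarrow> bool" where
  "involves \<Delta> b a \<longleftrightarrow> representation \<Delta> b a \<noteq> 0"

text \<open>
  Distinct simple roots \<open>a\<close>, \<open>b\<close> are joined in the Coxeter diagram iff the product of their
  reflections has order at least 3.
\<close>

definition coxeter_edge :: "'a::euclidean_space \<Rightarrow> 'a \<Rightarrow> bool" where
  "coxeter_edge a b \<longleftrightarrow>
     a \<noteq> b \<and> (\<forall>k. 0 < k \<and> k < 3 \<longrightarrow> ((refl_root a \<circ> refl_root b) ^^ k) \<noteq> id)"

definition totally_disconnected :: "'a::euclidean_space set \<Rightarrow> bool" where
  "totally_disconnected J \<longleftrightarrow> (\<forall>a\<in>J. \<forall>b\<in>J. \<not> coxeter_edge a b)"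

text \<open>
  \<open>P\<close> and \<open>N\<close> stand for \<open>I\<^sub>+\<close> and \<open>I\<^sub>-\<close>.
\<close>

definition bipartition :: "'a::euclidean_space set \<Rightarrow> 'a set \<Rightarrow> 'a set \<Rightarrow> bool" where
  "bipartition \<Delta> P N \<longleftrightarrow>
     P \<union> N = \<Delta> \<and> P \<inter> N = {} \<and> totally_disconnected P \<and> totally_disconnected N"

text \<open>
  The involution for \<open>\<epsilon>\<close> is \<open>tau J K\<close> with \<open>J = I\<^sub>\<epsilon>\<close> and \<open>K\<close> the other part. The order of the
  reflections in the fold is irrelevant as the reflections in a totally disconnected set of
  simple roots commute.
\<close>

definition tau :: "'a::euclidean_space set \<Rightarrow> 'a set \<Rightarrow> 'a \<Rightarrow> 'a" where
  "tau J K v = (if v \<in> uminus ` K then v else Finite_Set.fold refl_root v J)"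

definition rot :: "'a::euclidean_space set \<Rightarrow> 'a set \<Rightarrow> 'a \<Rightarrow> 'a" where
  "rot P N = tau N P \<circ> tau P N"

text \<open>
  The last clause fixes the convention for two negative simple roots: distinct ones are
  compatible, and none is compatible with itself. Without such a clause the relation is not
  unique, since two negative simple roots may have no common translate under \<open>rot\<close> with
  exactly one negative member. This choice makes the rule for \<open>- a\<close> hold for all almost
  positive \<open>b\<close>, because the expansion of \<open>- a\<close> involves \<open>a\<close>.
\<close>

definition is_compatibility ::
    "'a::euclidean_space set \<Rightarrow> 'a set \<Rightarrow> 'a set \<Rightarrow> 'a set \<Rightarrow> ('a \<times> 'a) set \<Rightarrow> bool" where
  "is_compatibility \<Phi> \<Delta> P N C \<longleftrightarrow>
     C \<subseteq> almost_positive_roots \<Phi> \<Delta> \<times> almost_positive_roots \<Phi> \<Delta> \<and>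
     sym C \<and>
     (\<forall>a\<in>almost_positive_roots \<Phi> \<Delta>. \<forall>b\<in>almost_positive_roots \<Phi> \<Delta>.
        (a, b) \<in> C \<longleftrightarrow> (rot P N a, rot P N b) \<in> C) \<and>
     (\<forall>a\<in>\<Delta>. \<forall>b\<in>positive_roots \<Phi> \<Delta>. (- a, b) \<in> C \<longleftrightarrow> \<not> involves \<Delta> b a) \<and>
     (\<forall>a\<in>\<Delta>. \<forall>b\<in>\<Delta>. (- a, - b) \<in> C \<longleftrightarrow> a \<noteq> b)"

definition compatibility ::
    "'a::euclidean_space set \<Rightarrow> 'a set \<Rightarrow> 'a set \<Rightarrow> 'a set \<Rightarrow> ('a \<times> 'a) set" where
  "compatibility \<Phi> \<Delta> P N = (THE C. is_compatibility \<Phi> \<Delta> P N C)"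

definition depth ::
    "'a::euclidean_space set \<Rightarrow> 'a set \<Rightarrow> 'a set \<Rightarrow> 'a set \<Rightarrow> 'a \<Rightarrow> nat" where
  "depth \<Phi> \<Delta> P N b = (LEAST d. - ((rot P N ^^ d) b) \<in> positive_roots \<Phi> \<Delta>)"

text \<open>
  The colored root \<open>\<alpha>\<^sup>k\<close> is the pair \<open>(\<alpha>, k)\<close>.
\<close>

definition colored_roots ::
    "'a::euclidean_space set \<Rightarrow> 'a set \<Rightarrow> nat \<Rightarrow> ('a \<times> nat) set" where
  "colored_roots \<Phi> \<Delta> m = positive_roots \<Phi> \<Delta> \<times> {1..m} \<union> (uminus ` \<Delta>) \<times> {1}"

text \<open>
  The number \<open>m\<close> of colors does not occur in the defining formula, so it is stated for all
  pairs of a vector and a color and applied to colored roots. It thereby also makes sense for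
  \<open>m = 0\<close>, where \<open>colored_rot\<close> can leave the set of colored roots.
\<close>

definition colored_compatible ::
    "'a::euclidean_space set \<Rightarrow> 'a set \<Rightarrow> 'a set \<Rightarrow> 'a set \<Rightarrow> 'a \<times> nat \<Rightarrow> 'a \<times> nat \<Rightarrow> bool" where
  "colored_compatible \<Phi> \<Delta> P N = (\<lambda>(a, k) (b, l).
     let R = rot P N; d = depth \<Phi> \<Delta> P N; C = compatibility \<Phi> \<Delta> P N in
       k > l \<and> d a \<le> d b \<and> (R a, b) \<in> C \<or>
       k < l \<and> d a \<ge> d b \<and> (a, R b) \<in> C \<or>
       k > l \<and> d a > d b \<and> (a, b) \<in> C \<or>
       k < l \<and> d a < d b \<and> (a, b) \<in> C \<or>
       k = l \<and> (a, b) \<in> C)"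

definition colored_rot ::
    "'a::euclidean_space set \<Rightarrow> 'a set \<Rightarrow> 'a set \<Rightarrow> 'a set \<Rightarrow> nat \<Rightarrow> 'a \<times> nat \<Rightarrow> 'a \<times> nat" where
  "colored_rot \<Phi> \<Delta> P N m = (\<lambda>(a, k).
     if a \<in> positive_roots \<Phi> \<Delta> \<and> k < m then (a, k + 1) else (rot P N a, 1))"

end

theory Submission
  imports Defs
begin

text \<open>
  Write \<open>c\<close> for the bipartite Coxeter element, the product of the reflections in \<open>P\<close> followed by
  those in \<open>N\<close>. The rotation \<open>R\<close> agrees with \<open>c\<close> except that it interposes the negative
  simple roots: a positive root moves along its orbit under \<open>c\<close>, lands on a negative simple root
  after as many steps as its depth says, and restarts from there. Since every orbit meets a negative
  simple root, a relation that is invariant under \<open>R\<close> (or under its colored version) is determined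
  by its values at negative simple roots. This gives uniqueness in both the colored and the
  non-colored case. Two facts remain: the non-colored relation exists, and the colored one is invariant.
  
  The invariance is a check of cases. A colored root either moves to the next color or is rotated
  and goes back to color 1. If both roots do the same, or if a positive root is rotated while the
  other one changes color, the invariance of the non-colored relation and the fact that \<open>R\<close> lowers
  the depth of a positive root by one are enough. The case that has content is the one of a
  negative simple root \<open>- a\<close> that is rotated while a positive root \<open>y\<close> changes color. If the
  depth of \<open>y\<close> is at most that of \<open>R (- a)\<close>, invariance again suffices. The lemma
  \<open>depth_overshoot\<close> says that otherwise \<open>a\<close> is in \<open>P\<close> and \<open>y\<close> is a simple root in
  \<open>N\<close>; then \<open>y = R (- y)\<close>, and \<open>y\<close> is compatible both with \<open>- a\<close> and with \<open>R (- a)\<close>.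
  
  Thus the return times from the negative simple roots have to be compared, and here
  irreducibility enters. A Perron-Frobenius vector of the Coxeter diagram gives two linear
  functionals, which together map the root space to a plane. The image of a root has two
  nonnegative coordinates if the root is positive and two nonpositive ones if it is negative, and the
  reflections in \<open>P\<close> and in \<open>N\<close> act on this plane. Simple roots of the same part lie on a common
  ray, so the time after which such a ray leaves the positive quadrant depends only on the part, and
  the two rays follow each other in alternation, so their exit times differ by at most one
  (\<open>exit_times\<close>).
  
  For the existence of the non-colored relation, let \<open>E\<close> be the Euler form of the
  bipartite orientation of the diagram. It satisfies \<open>E (c x, y) = - E (y, x)\<close> and hence
  \<open>E (c x, c y) = E (x, y)\<close>. If \<open>x\<close> is deeper than \<open>y\<close>, define \<open>x\<close> and \<open>y\<close> to be
  compatible if \<open>E (y, x) = 0\<close>, where a negative simple root is first replaced by a vector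
  (\<open>root_class\<close>) that makes \<open>R\<close> act like \<open>c\<close>; two different roots of the same depth are always compatible.
  Invariance under \<open>c\<close> gives invariance under \<open>R\<close> as long as both roots are positive. When one
  root is negative and is rotated, the order of depths is reversed, apart from the exceptional case
  above, and this is compensated by the first identity for \<open>E\<close>.
\<close>

section \<open>Products of orthogonal reflections\<close>

definition refl_prod :: "'a::euclidean_space set \<Rightarrow> 'a \<Rightarrow> 'a" where
  "refl_prod J v = v - (\<Sum>a\<in>J. (2 * (v \<bullet> a) / (a \<bullet> a)) *\<^sub>R a)"

lemma refl_root_commute:
  assumes "a \<bullet> b = 0"
  shows "refl_root a (refl_root b v) = refl_root b (refl_root a v)"
  using assms by (simp add: refl_root_def algebra_simps inner_commute)

lemma fold_refl_root:
  assumes "finite J" "pairwise orthogonal J"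
  shows "Finite_Set.fold refl_root v J = refl_prod J v"
proof -
  interpret comp_fun_commute_on J refl_root
  proof
    fix a b assume "a \<in> J" "b \<in> J"
    then show "refl_root b \<circ> refl_root a = refl_root a \<circ> refl_root b"
      using assms(2) refl_root_commute[of a b]
      by (cases "a = b") (simp_all add: fun_eq_iff pairwise_def orthogonal_def)
  qed
  have "Finite_Set.fold refl_root v K = refl_prod K v" if "K \<subseteq> J" for K
    using finite_subset[OF that assms(1)] that
  proof (induction K rule: finite_induct)
    case empty
    then show ?case by (simp add: refl_prod_def)
  next
    case (insert a K)
    have "b \<bullet> a = 0" if "b \<in> K" for b
    proof -
      have "b \<noteq> a" "b \<in> J" "a \<in> J" using insert that by auto
      then show ?thesis using assms(2) by (auto simp: pairwise_def orthogonal_def)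
    qed
    then have "refl_prod K v \<bullet> a = v \<bullet> a"
      by (simp add: refl_prod_def inner_diff_left inner_sum_left)
    then have "refl_root a (refl_prod K v) = refl_prod (insert a K) v"
      using insert by (simp add: refl_root_def refl_prod_def)
    then show ?case
      using insert by (subst fold_insert) auto
  qed
  then show ?thesis by blast
qed

lemma refl_prod_scale: "refl_prod J (r *\<^sub>R x) = r *\<^sub>R refl_prod J x"
  by (simp add: refl_prod_def scaleR_sum_right algebra_simps)

lemma refl_prod_minus: "refl_prod J (- x) = - refl_prod J x"
  using refl_prod_scale[of J "-1" x] by simp

lemma sum_orthogonal_single:
  assumes "finite J" "pairwise orthogonal J" "b \<in> J"
  shows "(\<Sum>a\<in>J. r a *\<^sub>R a) \<bullet> b = r b * (b \<bullet> b)"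
proof -
  have "(\<Sum>a\<in>J. r a *\<^sub>R a) \<bullet> b = (\<Sum>a\<in>J. if a = b then r b * (b \<bullet> b) else 0)"
    unfolding inner_sum_left
    by (rule sum.cong) (use assms in \<open>auto simp: pairwise_def orthogonal_def\<close>)
  then show ?thesis using assms by simp
qed

lemma refl_prod_inner:
  assumes "finite J" "pairwise orthogonal J" "b \<in> J"
  shows "refl_prod J x \<bullet> b = - (x \<bullet> b)"
  using sum_orthogonal_single[OF assms, of "\<lambda>a. 2 * (x \<bullet> a) / (a \<bullet> a)"]
  by (cases "b = 0") (simp_all add: refl_prod_def inner_diff_left)

lemma refl_prod_refl_prod:
  assumes "finite J" "pairwise orthogonal J"
  shows "refl_prod J (refl_prod J x) = x"
proof -
  have "(\<Sum>a\<in>J. (2 * (refl_prod J x \<bullet> a) / (a \<bullet> a)) *\<^sub>R a) =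
        - (\<Sum>a\<in>J. (2 * (x \<bullet> a) / (a \<bullet> a)) *\<^sub>R a)"
    using refl_prod_inner[OF assms]
    by (simp add: sum_negf[symmetric] del: sum_negf)
  then show ?thesis by (subst refl_prod_def) (simp add: refl_prod_def)
qed

lemma refl_prod_member:
  assumes "finite J" "pairwise orthogonal J" "b \<in> J"
  shows "refl_prod J b = - b"
proof -
  have "(\<Sum>a\<in>J. (2 * (b \<bullet> a) / (a \<bullet> a)) *\<^sub>R a) = (\<Sum>a\<in>J. if a = b then 2 *\<^sub>R b else 0)"
    by (rule sum.cong) (use assms in \<open>auto simp: pairwise_def orthogonal_def\<close>)
  then show ?thesis using assms by (simp add: refl_prod_def scaleR_2)
qed

text \<open>
  If \<open>a\<close> and \<open>b\<close> are not joined, the product of their reflections has order one or two. Evaluating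
  this at \<open>b\<close> yields a linear relation between \<open>a\<close> and \<open>b\<close>, whose coefficients vanish only
  if \<open>a\<close> and \<open>b\<close> are orthogonal.
\<close>

lemma non_edge_orthogonal:
  assumes "\<not> coxeter_edge a b" "a \<noteq> b" "independent {a, b}"
  shows "orthogonal a b"
proof -
  have a0: "a \<noteq> 0" "b \<noteq> 0" using assms(3) dependent_zero by blast+
  have lin: "r = 0 \<and> s = 0" if "r *\<^sub>R a + s *\<^sub>R b = 0" for r s
  proof -
    have "(\<Sum>v\<in>{a,b}. (if v = a then r else s) *\<^sub>R v) = 0" using that assms(2) by simp
    then have "(if v = a then r else s) = 0" if "v \<in> {a, b}" for v
      using independentD[OF assms(3) finite.insertI[OF finite.insertI[OF finite.emptyI]] subset_refl _ that, of "\<lambda>v. if v = a then r else s"] by simp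
    from this[of a] this[of b] show ?thesis using assms(2) by simp
  qed
  define t where "t = 2 * (b \<bullet> a) / (a \<bullet> a)"
  define u where "u = 2 * (a \<bullet> b) / (b \<bullet> b)"
  have sab: "refl_root a b = b - t *\<^sub>R a" "refl_root b b = - b" "refl_root a a = - a"
    "refl_root b a = a - u *\<^sub>R b"
    using a0 by (simp_all add: refl_root_def t_def u_def scaleR_2)
  have lb: "refl_root x (y + z) = refl_root x y + refl_root x z"
    "refl_root x (r *\<^sub>R y) = r *\<^sub>R refl_root x y" "refl_root x (- y) = - refl_root x y"
    "refl_root x (y - z) = refl_root x y - refl_root x z" for x y z :: 'a and r
    by (simp_all add: refl_root_def algebra_simps add_divide_distrib diff_divide_distrib)
  from assms(1,2) obtain k where k: "0 < k" "k < (3::nat)" "((refl_root a \<circ> refl_root b) ^^ k) = id"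
    by (auto simp: coxeter_edge_def)
  then have "k = 1 \<or> k = 2" by auto
  then have "t = 0"
  proof
    assume "k = 1"
    then have "refl_root a (refl_root b b) = b" using k(3) by (simp add: fun_eq_iff)
    then have "t *\<^sub>R a + (-2) *\<^sub>R b = 0" by (simp add: sab lb algebra_simps scaleR_2)
    then show ?thesis using lin[of t "- 2"] by simp
  next
    assume "k = 2"
    then have "refl_root a (refl_root b (refl_root a (refl_root b b))) = b"
      using k(3) by (simp add: fun_eq_iff numeral_2_eq_2)
    then have "(- t - t + t * u * t) *\<^sub>R a + (- t * u) *\<^sub>R b = 0"
      by (simp add: sab lb algebra_simps) (simp add: mult.commute flip: scaleR_2)
    then have "- t - t + t * u * t = 0" "- t * u = 0"
      using lin[of "- t - t + t * u * t" "- t * u"] by simp_all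
    then show ?thesis by auto
  qed
  then show ?thesis using a0 by (simp add: t_def orthogonal_def inner_commute)
qed


section \<open>Roots and simple roots\<close>

text \<open>
  The hypotheses are symmetric in \<open>P\<close> and \<open>N\<close> (lemma \<open>swap\<close> below), so that facts about
  one part are proved for \<open>P\<close> and transferred to \<open>N\<close>.
\<close>

locale bipartite_roots =
  fixes \<Phi> \<Delta> P N :: "'a::euclidean_space set"
  assumes root_system: "root_system \<Phi>"
    and irreducible: "irreducible_roots \<Phi>"
    and simple_system: "simple_system \<Phi> \<Delta>"
    and bipartition: "bipartition \<Delta> P N"
begin

abbreviation rep :: "'a \<Rightarrow> 'a \<Rightarrow> real" where "rep \<equiv> representation \<Delta>"
abbreviation pos :: "'a set" where "pos \<equiv> positive_roots \<Phi> \<Delta>"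
abbreviation almost_pos :: "'a set" where "almost_pos \<equiv> almost_positive_roots \<Phi> \<Delta>"

lemma swap: "bipartite_roots \<Phi> \<Delta> N P"
  using root_system irreducible simple_system bipartition
  by (unfold_locales) (auto simp: bipartition_def)

lemma indep: "independent \<Delta>"
  using simple_system by (simp add: simple_system_def)

lemma finite_simple: "finite \<Delta>"
  using indep independent_imp_finite by blast

lemma finite_roots: "finite \<Phi>"
  using root_system by (simp add: root_system_def)

lemma simple_root: "a \<in> \<Delta> \<Longrightarrow> a \<in> \<Phi>"
  using simple_system by (auto simp: simple_system_def)

lemma root_span: "x \<in> \<Phi> \<Longrightarrow> x \<in> span \<Delta>"
  using simple_system by (auto simp: simple_system_def)

lemma root_nonzero: "x \<in> \<Phi> \<Longrightarrow> x \<noteq> 0"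
  using root_system by (auto simp: root_system_def)

lemma simple_inner_pos: "a \<in> \<Delta> \<Longrightarrow> 0 < a \<bullet> a"
  using root_nonzero simple_root by auto

lemma refl_root_root: "a \<in> \<Phi> \<Longrightarrow> x \<in> \<Phi> \<Longrightarrow> refl_root a x \<in> \<Phi>"
  using root_system unfolding root_system_def by blast

lemma uminus_root: "x \<in> \<Phi> \<Longrightarrow> - x \<in> \<Phi>"
  using refl_root_root[of x x] root_nonzero[of x] by (simp add: refl_root_def scaleR_2)

lemma root_multiple: "x \<in> \<Phi> \<Longrightarrow> r *\<^sub>R x \<in> \<Phi> \<Longrightarrow> r *\<^sub>R x = x \<or> r *\<^sub>R x = - x"
  using root_system unfolding root_system_def by blast

lemma rep_add: "x \<in> span \<Delta> \<Longrightarrow> y \<in> span \<Delta> \<Longrightarrow> rep (x + y) a = rep x a + rep y a"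
  by (simp add: representation_add indep)

lemma rep_diff: "x \<in> span \<Delta> \<Longrightarrow> y \<in> span \<Delta> \<Longrightarrow> rep (x - y) a = rep x a - rep y a"
  by (simp add: representation_diff indep)

lemma rep_minus: "x \<in> span \<Delta> \<Longrightarrow> rep (- x) a = - rep x a"
  by (simp add: representation_neg indep)

lemma rep_scale: "x \<in> span \<Delta> \<Longrightarrow> rep (r *\<^sub>R x) a = r * rep x a"
  by (simp add: representation_scale indep)

lemma rep_simple: "b \<in> \<Delta> \<Longrightarrow> rep b a = (if a = b then 1 else 0)"
  by (simp add: representation_basis indep)

lemma rep_sum:
  assumes "K \<subseteq> \<Delta>"
  shows "rep (\<Sum>b\<in>K. r b *\<^sub>R b) a = (if a \<in> K then r a else 0)"
proof -
  have fin: "finite K" using assms finite_simple finite_subset by blast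
  have "rep (\<Sum>b\<in>K. r b *\<^sub>R b) a = (\<Sum>b\<in>K. rep (r b *\<^sub>R b) a)"
    using assms by (subst representation_sum) (auto simp: indep span_base span_scale subset_iff)
  also have "\<dots> = (\<Sum>b\<in>K. if a = b then r b else 0)"
    by (rule sum.cong) (use assms in \<open>auto simp: rep_scale span_base rep_simple subset_iff\<close>)
  finally show ?thesis using fin by simp
qed

lemma expansion: "x \<in> span \<Delta> \<Longrightarrow> (\<Sum>a\<in>\<Delta>. rep x a *\<^sub>R a) = x"
  using sum_representation_eq[OF indep _ finite_simple] by blast

lemma span_sum_simple: "K \<subseteq> \<Delta> \<Longrightarrow> (\<Sum>b\<in>K. r b *\<^sub>R b) \<in> span \<Delta>"
  by (intro span_sum span_scale span_base) auto

lemma pos_root: "x \<in> pos \<Longrightarrow> x \<in> \<Phi>"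
  by (simp add: positive_roots_def)

lemma rep_pos: "x \<in> pos \<Longrightarrow> a \<in> \<Delta> \<Longrightarrow> 0 \<le> rep x a"
  by (simp add: positive_roots_def)

lemma pos_or_neg: "x \<in> \<Phi> \<Longrightarrow> x \<in> pos \<or> - x \<in> pos"
  using simple_system uminus_root[of x] root_span[of x]
  by (auto simp: simple_system_def positive_roots_def rep_minus)

lemma rep_nonzero: "\<exists>a\<in>\<Delta>. rep x a \<noteq> 0" if "x \<in> \<Phi>"
proof (rule ccontr)
  assume "\<not> ?thesis"
  then show False using expansion[OF root_span[OF that]] root_nonzero[OF that] by simp
qed

lemma rep_pos_ex: "x \<in> pos \<Longrightarrow> \<exists>a\<in>\<Delta>. 0 < rep x a"
  using rep_nonzero[of x] rep_pos[of x] pos_root[of x] by force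

lemma not_pos_neg: "x \<in> pos \<Longrightarrow> - x \<notin> pos"
  using rep_pos_ex[of x] rep_pos[of "- x"] root_span[of x] pos_root[of x]
  by (force simp: rep_minus)

lemma posI: "x \<in> \<Phi> \<Longrightarrow> a \<in> \<Delta> \<Longrightarrow> 0 < rep x a \<Longrightarrow> x \<in> pos"
  using pos_or_neg[of x] rep_pos[of "- x" a] root_span[of x] by (force simp: rep_minus)

lemma simple_pos: "a \<in> \<Delta> \<Longrightarrow> a \<in> pos"
  by (rule posI[of _ a]) (auto simp: simple_root rep_simple)

text \<open>
  The reflection of \<open>b\<close> in \<open>a\<close> still involves \<open>b\<close> with coefficient 1. It is therefore positive,
  and its coefficient at \<open>a\<close>, a negative multiple of the inner product, has to be nonnegative.
\<close>

lemma simple_nonpos_inner: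
  assumes "a \<in> \<Delta>" "b \<in> \<Delta>" "a \<noteq> b"
  shows "a \<bullet> b \<le> 0"
proof -
  let ?x = "refl_root a b"
  have x: "?x \<in> \<Phi>" using assms refl_root_root simple_root by blast
  have r: "rep ?x c = rep b c - (2 * (b \<bullet> a) / (a \<bullet> a)) * rep a c" for c
    using assms by (simp add: refl_root_def rep_diff rep_scale span_base span_scale)
  have "?x \<in> pos" using r[of b] assms by (intro posI[OF x, of b]) (auto simp: rep_simple)
  from rep_pos[OF this assms(1)] have "2 * (b \<bullet> a) / (a \<bullet> a) \<le> 0"
    using r[of a] assms by (simp add: rep_simple)
  then show ?thesis using simple_inner_pos[OF assms(1)]
    by (simp add: divide_le_0_iff inner_commute)
qed

lemma P_subset: "P \<subseteq> \<Delta>" and N_subset: "N \<subseteq> \<Delta>"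
  and P_Un_N: "\<Delta> = P \<union> N" and P_Int_N: "P \<inter> N = {}"
  using bipartition by (auto simp: bipartition_def)

lemma finite_P: "finite P"
  using P_subset finite_simple finite_subset by blast

lemma orthogonal_P: "pairwise orthogonal P"
  unfolding pairwise_def
proof (intro ballI impI)
  fix a b assume ab: "a \<in> P" "b \<in> P" "a \<noteq> b"
  then have "\<not> coxeter_edge a b"
    using bipartition by (auto simp: bipartition_def totally_disconnected_def)
  moreover have "independent {a, b}"
    using ab P_subset by (intro independent_mono[OF indep]) auto
  ultimately show "orthogonal a b" using ab(3) non_edge_orthogonal by blast
qed

lemma P_orth: "a \<in> P \<Longrightarrow> b \<in> P \<Longrightarrow> a \<noteq> b \<Longrightarrow> a \<bullet> b = 0"
  using orthogonal_P by (auto simp: pairwise_def orthogonal_def)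

lemmas finite_N = bipartite_roots.finite_P[OF swap]
lemmas orthogonal_N = bipartite_roots.orthogonal_P[OF swap]

abbreviation sP :: "'a \<Rightarrow> 'a" where "sP \<equiv> refl_prod P"
abbreviation sN :: "'a \<Rightarrow> 'a" where "sN \<equiv> refl_prod N"

lemmas sP_sP = refl_prod_refl_prod[OF finite_P orthogonal_P]
lemmas sP_simple = refl_prod_member[OF finite_P orthogonal_P]
lemmas sN_sN = refl_prod_refl_prod[OF finite_N orthogonal_N]
lemmas sN_simple = refl_prod_member[OF finite_N orthogonal_N]

lemma sP_span: "x \<in> span \<Delta> \<Longrightarrow> sP x \<in> span \<Delta>"
  unfolding refl_prod_def by (intro span_diff span_sum_simple P_subset)

lemma rep_sP:
  assumes "x \<in> span \<Delta>"
  shows "rep (sP x) a = (if a \<in> P then rep x a - 2 * (x \<bullet> a) / (a \<bullet> a) else rep x a)"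
  using assms unfolding refl_prod_def
  by (simp add: rep_diff span_sum_simple P_subset rep_sum)

lemma sP_root: "x \<in> \<Phi> \<Longrightarrow> sP x \<in> \<Phi>"
proof -
  assume x: "x \<in> \<Phi>"
  have "refl_prod K x \<in> \<Phi>" if "K \<subseteq> P" for K
    using finite_subset[OF that finite_P] that
  proof (induction K rule: finite_induct)
    case empty
    then show ?case using x by (simp add: refl_prod_def)
  next
    case (insert a K)
    have "b \<bullet> a = 0" if "b \<in> K" for b
      using insert that by (intro P_orth) auto
    then have "refl_prod K x \<bullet> a = x \<bullet> a"
      by (simp add: refl_prod_def inner_diff_left inner_sum_left)
    then have "refl_prod (insert a K) x = refl_root a (refl_prod K x)"
      using insert by (simp add: refl_root_def refl_prod_def)
    then show ?case using insert refl_root_root simple_root P_subset by auto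
  qed
  then show ?thesis by blast
qed

text \<open>
  Reflecting \<open>x\<close> in a simple root \<open>a\<close> of its support negates the coefficient at \<open>a\<close> and keeps the
  others, because \<open>P\<close> is orthogonal. Any further simple root in the support would give a root with
  coefficients of both signs.
\<close>

lemma pos_span_P:
  assumes "x \<in> pos" "\<And>a. a \<in> N \<Longrightarrow> rep x a = 0"
  shows "x \<in> P"
proof -
  have x: "x \<in> \<Phi>" "x \<in> span \<Delta>" using assms pos_root root_span by auto
  obtain a where a: "a \<in> \<Delta>" "0 < rep x a" using rep_pos_ex assms(1) by blast
  then have aP: "a \<in> P" using assms(2) P_Un_N by force
  have ex: "(\<Sum>b\<in>P. rep x b *\<^sub>R b) = x"
    using expansion[OF x(2)] assms(2) P_Un_N P_Int_N finite_P finite_N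
    by (simp add: sum.union_disjoint)
  have xa: "x \<bullet> a = rep x a * (a \<bullet> a)"
    using sum_orthogonal_single[OF finite_P orthogonal_P aP, of "rep x"] ex by simp
  let ?y = "refl_root a x"
  have y: "?y \<in> \<Phi>" using refl_root_root simple_root a x by blast
  have ry: "rep ?y b = rep x b - 2 * rep x a * rep a b" for b
    using x a root_nonzero[OF simple_root[OF a(1)]] xa
    by (simp add: refl_root_def rep_diff rep_scale span_base span_scale)
  have other: "rep x b = 0" if "b \<in> \<Delta>" "b \<noteq> a" for b
  proof (rule ccontr)
    assume "rep x b \<noteq> 0"
    then have "0 < rep x b" using rep_pos[OF assms(1) that(1)] by simp
    then have "?y \<in> pos" using ry[of b] that a by (intro posI[OF y that(1)]) (simp add: rep_simple)
    from rep_pos[OF this a(1)] show False using ry[of a] a by (simp add: rep_simple)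
  qed
  have "x = (\<Sum>b\<in>\<Delta>. if b = a then rep x a *\<^sub>R a else 0)"
    by (subst expansion[OF x(2), symmetric]) (rule sum.cong, auto simp: other)
  then have xr: "x = rep x a *\<^sub>R a" using a finite_simple by simp
  then have "x = a \<or> x = - a" using root_multiple[OF simple_root[OF a(1)]] x by metis
  moreover have "x \<noteq> - a" using not_pos_neg[OF simple_pos[OF a(1)]] assms(1) by auto
  ultimately show ?thesis using aP by simp
qed

text \<open>
  The reflections in \<open>P\<close> do not change the coefficients at \<open>N\<close>, and one of these is positive.
\<close>

lemma sP_pos:
  assumes "x \<in> pos" "x \<notin> P"
  shows "sP x \<in> pos" "sP x \<notin> P"
proof -
  obtain a where a: "a \<in> N" "rep x a \<noteq> 0" using pos_span_P assms by blast
  then have aD: "a \<in> \<Delta>" "a \<notin> P" using N_subset P_Int_N by auto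
  have x: "x \<in> \<Phi>" "x \<in> span \<Delta>" using assms pos_root root_span by auto
  have "0 < rep x a" using a rep_pos[OF assms(1) aD(1)] by simp
  then have r: "0 < rep (sP x) a" using rep_sP[OF x(2)] aD by simp
  show "sP x \<in> pos" using posI[OF sP_root[OF x(1)] aD(1) r] .
  show "sP x \<notin> P"
  proof
    assume p: "sP x \<in> P"
    then show False using r aD P_subset rep_simple[of "sP x" a] by (auto split: if_splits)
  qed
qed

lemmas sN_span = bipartite_roots.sP_span[OF swap]
lemmas sN_root = bipartite_roots.sP_root[OF swap]
lemmas sN_pos = bipartite_roots.sP_pos[OF swap]


section \<open>Irreducibility\<close>

definition height :: "'a \<Rightarrow> real" where
  "height x = (\<Sum>a\<in>\<Delta>. rep x a)"

lemma rep_refl_root: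
  assumes "a \<in> \<Delta>" "x \<in> span \<Delta>"
  shows "rep (refl_root a x) b = rep x b - (if b = a then 2 * (x \<bullet> a) / (a \<bullet> a) else 0)"
  using assms by (simp add: refl_root_def rep_diff rep_scale rep_simple span_base span_scale)

text \<open>
  Fix a decomposition of the simple roots into two orthogonal sets. A root whose support meets both
  sets can be reflected in a simple root that has a positive inner product with it. This lowers the
  height, and the new support still meets both sets: if \<open>a\<close> were the only simple root of its set
  in the support of \<open>x\<close>, then the reflection would negate its coefficient instead of removing it.
\<close>

lemma mixed_root_descent:
  assumes orth: "\<And>a b. a \<in> A \<Longrightarrow> b \<in> \<Delta> - A \<Longrightarrow> a \<bullet> b = 0" and "A \<subseteq> \<Delta>"
    and x: "x \<in> pos" "p \<in> A" "rep x p \<noteq> 0" "q \<in> \<Delta> - A" "rep x q \<noteq> 0"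
    and a: "a \<in> A" "0 < rep x a" "0 < x \<bullet> a"
  shows "\<exists>y\<in>pos. (\<exists>p\<in>A. rep y p \<noteq> 0) \<and> (\<exists>q\<in>\<Delta> - A. rep y q \<noteq> 0) \<and> height y < height x"
proof
  let ?y = "refl_root a x" and ?t = "2 * (x \<bullet> a) / (a \<bullet> a)"
  have aD: "a \<in> \<Delta>" using a assms(2) by auto
  have x': "x \<in> \<Phi>" "x \<in> span \<Delta>" using x pos_root root_span by auto
  note ry = rep_refl_root[OF aD x'(2)]
  have t: "0 < ?t" using a simple_inner_pos[OF aD] by simp
  have "0 < rep x q" using x rep_pos[of x q] by auto
  moreover have "q \<noteq> a" using x(4) a by auto
  ultimately have yq: "0 < rep ?y q" using ry[of q] by simp
  show "?y \<in> pos" using yq x(4) by (intro posI[of _ q] refl_root_root simple_root aD x') auto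
  have "height ?y = height x - ?t"
    using finite_simple aD by (simp add: height_def ry sum_subtractf)
  moreover have "\<exists>p\<in>A. rep ?y p \<noteq> 0"
  proof (rule ccontr)
    assume "\<not> ?thesis"
    then have z: "rep x b = (if b = a then ?t else 0)" if "b \<in> A" for b
      using that ry[of b] by force
    have "x \<bullet> a = (\<Sum>b\<in>\<Delta>. rep x b *\<^sub>R b) \<bullet> a" using expansion[OF x'(2)] by simp
    also have "\<dots> = (\<Sum>b\<in>\<Delta>. if b = a then ?t * (a \<bullet> a) else 0)"
      unfolding inner_sum_left
    proof (rule sum.cong)
      fix b assume "b \<in> \<Delta>"
      then show "rep x b *\<^sub>R b \<bullet> a = (if b = a then ?t * (a \<bullet> a) else 0)"
        using z[of b] orth[of a b] a(1) by (cases "b \<in> A") (auto simp: inner_commute)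
    qed simp
    also have "\<dots> = ?t * (a \<bullet> a)" using finite_simple aD by simp
    also have "\<dots> = 2 * (x \<bullet> a)" using simple_inner_pos[OF aD] by simp
    finally show False using a by simp
  qed
  moreover have "\<exists>q\<in>\<Delta> - A. rep ?y q \<noteq> 0" using yq x(4) by force
  ultimately show "(\<exists>p\<in>A. rep ?y p \<noteq> 0) \<and> (\<exists>q\<in>\<Delta> - A. rep ?y q \<noteq> 0) \<and> height ?y < height x"
    using t by simp
qed

text \<open>
  A root of minimal height among those with mixed support would contradict \<open>mixed_root_descent\<close>.
\<close>

lemma root_support_connected:
  assumes orth: "\<And>a b. a \<in> A \<Longrightarrow> b \<in> \<Delta> - A \<Longrightarrow> a \<bullet> b = 0" and A: "A \<subseteq> \<Delta>"
    and x: "x \<in> pos"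
  shows "(\<forall>p\<in>A. rep x p = 0) \<or> (\<forall>q\<in>\<Delta> - A. rep x q = 0)"
proof (rule ccontr)
  define M where "M = {y \<in> pos. (\<exists>p\<in>A. rep y p \<noteq> 0) \<and> (\<exists>q\<in>\<Delta> - A. rep y q \<noteq> 0)}"
  assume "\<not> ?thesis"
  then have "M \<noteq> {}" using x by (auto simp: M_def)
  moreover have "finite M"
    by (rule finite_subset[OF _ finite_roots]) (auto simp: M_def pos_root)
  ultimately obtain y where y: "y \<in> M" "\<And>w. w \<in> M \<Longrightarrow> height y \<le> height w"
    by (metis arg_min_least arg_min_if_finite(1))
  then obtain p q where pq: "y \<in> pos" "p \<in> A" "rep y p \<noteq> 0" "q \<in> \<Delta> - A" "rep y q \<noteq> 0"
    by (auto simp: M_def)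
  have ysp: "y \<in> span \<Delta>" using pq pos_root root_span by blast
  have "\<exists>a\<in>\<Delta>. 0 < rep y a \<and> 0 < y \<bullet> a"
  proof (rule ccontr)
    assume c: "\<not> ?thesis"
    have "y \<bullet> y = y \<bullet> (\<Sum>a\<in>\<Delta>. rep y a *\<^sub>R a)" using expansion[OF ysp] by simp
    also have "\<dots> = (\<Sum>a\<in>\<Delta>. rep y a * (y \<bullet> a))" by (simp add: inner_sum_right)
    also have "\<dots> \<le> 0"
      using c rep_pos[OF pq(1)]
      by (intro sum_nonpos) (metis less_eq_real_def linorder_not_less mult_nonneg_nonpos mult_zero_left)
    finally show False using root_nonzero[OF pos_root[OF pq(1)]] by (meson inner_gt_zero_iff linorder_not_less)
  qed
  then obtain a where a: "a \<in> \<Delta>" "0 < rep y a" "0 < y \<bullet> a" by blast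
  have "\<exists>w\<in>M. height w < height y"
  proof (cases "a \<in> A")
    case True
    from mixed_root_descent[OF orth A pq True a(2,3)] show ?thesis by (auto simp: M_def)
  next
    case False
    have DD: "\<Delta> - (\<Delta> - A) = A" using A by auto
    have orth': "c \<bullet> d = 0" if "c \<in> \<Delta> - A" "d \<in> A" for c d
      using orth[OF that(2,1)] by (simp add: inner_commute)
    have "\<exists>w\<in>pos. (\<exists>p\<in>\<Delta> - A. rep w p \<noteq> 0) \<and> (\<exists>q\<in>\<Delta> - (\<Delta> - A). rep w q \<noteq> 0) \<and> height w < height y"
      by (rule mixed_root_descent[where p = q and q = p and a = a])
        (use orth' pq a False in \<open>auto simp: DD\<close>)
    then show ?thesis by (auto simp: M_def DD)
  qed
  then show False using y(2) by force
qed

text \<open>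
  Irreducibility is a property of all roots; this is its form for simple roots. An orthogonal
  decomposition of the simple roots sorts the roots by support into two mutually orthogonal sets.
\<close>

lemma simple_roots_connected:
  assumes "A \<subseteq> \<Delta>" "A \<noteq> {}" "A \<noteq> \<Delta>"
  shows "\<exists>a\<in>A. \<exists>b\<in>\<Delta> - A. a \<bullet> b \<noteq> 0"
proof (rule ccontr)
  assume "\<not> ?thesis"
  then have orth: "a \<bullet> b = 0" if "a \<in> A" "b \<in> \<Delta> - A" for a b using that by blast
  define X where "X = {x \<in> \<Phi>. \<forall>q\<in>\<Delta> - A. rep x q = 0}"
  define Y where "Y = {x \<in> \<Phi>. \<forall>p\<in>A. rep x p = 0}"
  have "A \<subseteq> X" using assms by (auto simp: X_def simple_root rep_simple)
  moreover have "\<Delta> - A \<subseteq> Y" using assms by (auto simp: Y_def simple_root rep_simple)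
  moreover have "X \<inter> Y = {}" using rep_nonzero by (fastforce simp: X_def Y_def)
  moreover have "X \<union> Y = \<Phi>"
  proof
    show "\<Phi> \<subseteq> X \<union> Y"
    proof
      fix x assume x: "x \<in> \<Phi>"
      have "x \<in> pos \<or> - x \<in> pos" using pos_or_neg x by blast
      then show "x \<in> X \<union> Y"
        using root_support_connected[OF orth assms(1), of x] root_support_connected[OF orth assms(1), of "- x"]
          x root_span[OF x] assms(1)
        by (auto simp: X_def Y_def rep_minus subset_iff)
    qed
  qed (auto simp: X_def Y_def)
  moreover have "x \<bullet> y = 0" if "x \<in> X" "y \<in> Y" for x y
  proof -
    have sp: "x \<in> span \<Delta>" "y \<in> span \<Delta>" using that root_span by (auto simp: X_def Y_def)
    have "x \<bullet> y = (\<Sum>a\<in>\<Delta>. rep x a *\<^sub>R a) \<bullet> (\<Sum>b\<in>\<Delta>. rep y b *\<^sub>R b)"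
      using expansion sp by simp
    also have "\<dots> = (\<Sum>a\<in>\<Delta>. \<Sum>b\<in>\<Delta>. rep y b * rep x a * (a \<bullet> b))"
      unfolding inner_sum_left inner_sum_right
      by (subst sum.swap) (simp add: algebra_simps)
    also have "\<dots> = 0"
    proof (intro sum.neutral ballI)
      fix a b assume "a \<in> \<Delta>" "b \<in> \<Delta>"
      then show "rep y b * rep x a * (a \<bullet> b) = 0"
        using that orth[of a b] by (cases "a \<in> A"; cases "b \<in> A") (auto simp: X_def Y_def)
    qed
    finally show ?thesis .
  qed
  moreover have "X \<noteq> {}" "Y \<noteq> {}"
    using \<open>A \<subseteq> X\<close> \<open>\<Delta> - A \<subseteq> Y\<close> assms by auto
  ultimately have "\<exists>X Y. X \<noteq> {} \<and> Y \<noteq> {} \<and> X \<inter> Y = {} \<and> X \<union> Y = \<Phi> \<and> (\<forall>a\<in>X. \<forall>b\<in>Y. a \<bullet> b = 0)"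
    by (intro exI[of _ X] exI[of _ Y]) simp
  then show False using irreducible unfolding irreducible_roots_def by simp
qed

section \<open>Projection to the Coxeter plane\<close>

lemma quadratic_nonneg_imp_linear_zero:
  fixes p q :: real
  assumes "\<And>t. 0 \<le> 2 * t * p + t\<^sup>2 * q"
  shows "p = 0"
proof (rule ccontr)
  assume p: "p \<noteq> 0"
  define Q where "Q = \<bar>q\<bar> + 1"
  have Q: "0 < Q" "q \<le> Q" by (auto simp: Q_def)
  have "0 \<le> 2 * (- p / Q) * p + (- p / Q)\<^sup>2 * q" using assms by blast
  also have "\<dots> \<le> 2 * (- p / Q) * p + (- p / Q)\<^sup>2 * Q"
    using Q by (intro add_left_mono mult_left_mono) auto
  also have "\<dots> = - (p\<^sup>2 / Q)" using Q by (simp add: power2_eq_square field_simps)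
  also have "\<dots> < 0" using p Q by simp
  finally show False by simp
qed

definition weight :: "'a \<Rightarrow> real" where
  "weight x = (\<Sum>b\<in>\<Delta>. (b \<bullet> b) * (rep x b)\<^sup>2)"

lemma compact_weight_sphere: "compact {x \<in> span \<Delta>. weight x = 1}"
proof -
  let ?B = "extend_basis \<Delta>"
  let ?f = "\<lambda>b x. representation ?B x b"
  have B: "independent ?B" "span ?B = UNIV" "\<Delta> \<subseteq> ?B"
    using independent_extend_basis[OF indep] span_extend_basis[OF indep] extend_basis_superset[OF indep]
    by auto
  have eq: "?f b x = rep x b" if "x \<in> span \<Delta>" for b x
    using representation_extend[OF B(1) that B(3)] by simp
  have "linear (?f b)" for b
    by (rule linearI) (simp_all add: representation_add representation_scale B)
  then have "continuous_on UNIV (?f b)" for b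
    by (simp add: linear_continuous_on linear_conv_bounded_linear)
  then have "continuous_on UNIV (\<lambda>x. \<Sum>b\<in>\<Delta>. (b \<bullet> b) * (?f b x)\<^sup>2)"
    by (intro continuous_intros)
  then have "closed ((\<lambda>x. \<Sum>b\<in>\<Delta>. (b \<bullet> b) * (?f b x)\<^sup>2) -` {1})"
    by (simp add: continuous_closed_vimage continuous_on_eq_continuous_at)
  then have "closed (span \<Delta> \<inter> (\<lambda>x. \<Sum>b\<in>\<Delta>. (b \<bullet> b) * (?f b x)\<^sup>2) -` {1})"
    by (intro closed_Int closed_span)
  moreover have "span \<Delta> \<inter> (\<lambda>x. \<Sum>b\<in>\<Delta>. (b \<bullet> b) * (?f b x)\<^sup>2) -` {1} = {x \<in> span \<Delta>. weight x = 1}"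
    using eq by (auto simp: weight_def)
  moreover have "norm x \<le> real (card \<Delta>)" if x: "x \<in> span \<Delta>" "weight x = 1" for x
  proof -
    have "norm (rep x b *\<^sub>R b) \<le> 1" if b: "b \<in> \<Delta>" for b
    proof -
      have "(b \<bullet> b) * (rep x b)\<^sup>2 \<le> weight x"
        unfolding weight_def using finite_simple b by (intro member_le_sum) auto
      then have "(norm (rep x b *\<^sub>R b))\<^sup>2 \<le> 1"
        using x by (simp add: power_mult_distrib power2_norm_eq_inner mult.commute)
      then show ?thesis by (simp add: abs_square_le_1)
    qed
    then have "(\<Sum>b\<in>\<Delta>. norm (rep x b *\<^sub>R b)) \<le> (\<Sum>b\<in>\<Delta>. 1)" by (intro sum_mono)
    then have "norm (\<Sum>b\<in>\<Delta>. rep x b *\<^sub>R b) \<le> real (card \<Delta>)"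
      using norm_sum[of "\<lambda>b. rep x b *\<^sub>R b" \<Delta>] by simp
    then show ?thesis using expansion[OF x(1)] by simp
  qed
  then have "bounded {x \<in> span \<Delta>. weight x = 1}" by (auto simp: bounded_iff)
  ultimately show ?thesis by (simp add: compact_eq_bounded_closed)
qed

lemma simple_nonempty: "\<Delta> \<noteq> {}"
  using irreducible rep_nonzero by (auto simp: irreducible_roots_def)

text \<open>
  The generalized Rayleigh quotient of the Gram matrix of the simple roots by its diagonal
  attains its minimum. Replacing all coefficients of a minimizer by their absolute values does not
  increase the quotient, because different simple roots have nonpositive inner products.
\<close>

lemma weight_minimizer:
  "\<exists>z\<in>span \<Delta>. weight z = 1 \<and> (\<forall>b\<in>\<Delta>. 0 \<le> rep z b) \<and>
     (\<forall>x\<in>span \<Delta>. (z \<bullet> z) * weight x \<le> x \<bullet> x)"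
proof -
  let ?K = "{x \<in> span \<Delta>. weight x = 1}"
  have scale: "weight (r *\<^sub>R x) = r\<^sup>2 * weight x" if "x \<in> span \<Delta>" for r x
    using that by (simp add: weight_def rep_scale power_mult_distrib sum_distrib_left algebra_simps)
  have weight_simple: "weight b = b \<bullet> b" if "b \<in> \<Delta>" for b
  proof -
    have "weight b = (\<Sum>a\<in>\<Delta>. if a = b then b \<bullet> b else 0)"
      unfolding weight_def by (rule sum.cong) (use that in \<open>auto simp: rep_simple\<close>)
    then show ?thesis using that finite_simple by simp
  qed
  obtain b where b: "b \<in> \<Delta>" using simple_nonempty by blast
  have "(1 / norm b) *\<^sub>R b \<in> ?K"
    using b simple_inner_pos[OF b]
    by (auto simp: scale weight_simple span_base span_scale power_divide power2_norm_eq_inner)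
  then have "?K \<noteq> {}" by blast
  moreover have "continuous_on ?K (\<lambda>x. x \<bullet> x)" by (intro continuous_intros)
  ultimately obtain z0 where z0: "z0 \<in> ?K" "\<And>y. y \<in> ?K \<Longrightarrow> z0 \<bullet> z0 \<le> y \<bullet> y"
    using continuous_attains_inf[OF compact_weight_sphere] by blast
  define z where "z = (\<Sum>b\<in>\<Delta>. \<bar>rep z0 b\<bar> *\<^sub>R b)"
  have z: "z \<in> span \<Delta>" "rep z b = \<bar>rep z0 b\<bar>" if "b \<in> \<Delta>" for b
    using that by (auto simp: z_def span_sum_simple rep_sum)
  have zsp: "z \<in> span \<Delta>" by (simp add: z_def span_sum_simple)
  have wz: "weight z = 1" using z0(1) by (simp add: weight_def z(2))
  have "z \<bullet> z = (\<Sum>b\<in>\<Delta>. \<Sum>a\<in>\<Delta>. \<bar>rep z0 a\<bar> * \<bar>rep z0 b\<bar> * (a \<bullet> b))"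
    by (simp add: z_def inner_sum_left inner_sum_right sum_distrib_left algebra_simps)
  also have "\<dots> \<le> (\<Sum>b\<in>\<Delta>. \<Sum>a\<in>\<Delta>. rep z0 a * rep z0 b * (a \<bullet> b))"
  proof (intro sum_mono)
    fix b a assume ab: "b \<in> \<Delta>" "a \<in> \<Delta>"
    show "\<bar>rep z0 a\<bar> * \<bar>rep z0 b\<bar> * (a \<bullet> b) \<le> rep z0 a * rep z0 b * (a \<bullet> b)"
    proof (cases "a = b")
      case False
      then have "a \<bullet> b \<le> 0" using ab simple_nonpos_inner by blast
      then show ?thesis by (intro mult_right_mono_neg) (simp_all add: abs_mult[symmetric])
    qed simp
  qed
  also have "\<dots> = (\<Sum>a\<in>\<Delta>. rep z0 a *\<^sub>R a) \<bullet> (\<Sum>b\<in>\<Delta>. rep z0 b *\<^sub>R b)"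
    by (simp add: inner_sum_left inner_sum_right sum_distrib_left algebra_simps)
  also have "\<dots> = z0 \<bullet> z0" using expansion z0(1) by simp
  finally have le: "z \<bullet> z \<le> y \<bullet> y" if "y \<in> ?K" for y using z0(2)[OF that] by simp
  have "(z \<bullet> z) * weight x \<le> x \<bullet> x" if x: "x \<in> span \<Delta>" for x
  proof -
    have "0 \<le> weight x" by (simp add: weight_def sum_nonneg)
    then consider "weight x = 0" | "0 < weight x" by linarith
    then show ?thesis
    proof cases
      case 2
      let ?y = "(1 / sqrt (weight x)) *\<^sub>R x"
      have "?y \<in> ?K" using x 2 by (simp add: scale span_scale power_divide)
      from le[OF this] have "z \<bullet> z \<le> (x \<bullet> x) / weight x" using 2 by simp
      then show ?thesis using 2 by (simp add: field_simps)
    qed simp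
  qed
  with zsp wz show ?thesis using z(2) by (intro bexI[of _ z]) auto
qed

text \<open>
  The minimizer is an eigenvector because the quadratic form that is the difference of the two
  sides of the minimality inequality is nonnegative and vanishes at \<open>z\<close>. If some coefficients were
  zero, the eigenvector equation would make the support of \<open>z\<close> orthogonal to its complement in the
  simple roots, against connectedness. The bounds on the eigenvalue hold because \<open>\<mu>\<close> is the
  squared norm of \<open>z\<close> and the quotient equals 1 at each simple root.
\<close>

lemma perron_frobenius:
  "\<exists>z \<mu>. z \<in> span \<Delta> \<and> 0 < \<mu> \<and> \<mu> \<le> 1 \<and>
     (\<forall>b\<in>\<Delta>. 0 < rep z b \<and> z \<bullet> b = \<mu> * ((b \<bullet> b) * rep z b))"
proof -
  obtain z where z: "z \<in> span \<Delta>" "weight z = 1" "\<And>b. b \<in> \<Delta> \<Longrightarrow> 0 \<le> rep z b"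
    "\<And>x. x \<in> span \<Delta> \<Longrightarrow> (z \<bullet> z) * weight x \<le> x \<bullet> x"
    using weight_minimizer by blast
  define \<mu> where "\<mu> = z \<bullet> z"
  have "z \<noteq> 0" using z(2) by (auto simp: weight_def representation_zero)
  then have \<mu>: "0 < \<mu>" by (simp add: \<mu>_def)
  have w: "weight (x + t *\<^sub>R b) = weight x + 2 * t * ((b \<bullet> b) * rep x b) + t\<^sup>2 * (b \<bullet> b)"
    if "b \<in> \<Delta>" "x \<in> span \<Delta>" for b t x
  proof -
    have "weight (x + t *\<^sub>R b) = (\<Sum>a\<in>\<Delta>. (a \<bullet> a) * (rep x a)\<^sup>2
        + (if a = b then 2 * t * ((b \<bullet> b) * rep x b) + t\<^sup>2 * (b \<bullet> b) else 0))"
      unfolding weight_def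
      by (rule sum.cong)
        (use that in \<open>auto simp: rep_add rep_scale rep_simple span_base span_scale
          power2_eq_square algebra_simps\<close>)
    then show ?thesis using that finite_simple by (simp add: sum.distrib weight_def)
  qed
  have eig: "z \<bullet> b = \<mu> * ((b \<bullet> b) * rep z b)" if b: "b \<in> \<Delta>" for b
  proof -
    have "0 \<le> 2 * t * (z \<bullet> b - \<mu> * ((b \<bullet> b) * rep z b)) + t\<^sup>2 * ((b \<bullet> b) * (1 - \<mu>))" for t
    proof -
      have "\<mu> * weight (z + t *\<^sub>R b) \<le> (z + t *\<^sub>R b) \<bullet> (z + t *\<^sub>R b)"
        using z(1,4) b by (simp add: \<mu>_def span_add span_base span_scale)
      moreover have "(z + t *\<^sub>R b) \<bullet> (z + t *\<^sub>R b) = \<mu> + 2 * t * (z \<bullet> b) + t\<^sup>2 * (b \<bullet> b)"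
        by (simp add: \<mu>_def algebra_simps inner_commute power2_eq_square)
      ultimately show ?thesis
        using w[OF b z(1), of t] z(2) by (simp add: algebra_simps)
    qed
    then show ?thesis using quadratic_nonneg_imp_linear_zero by fastforce
  qed
  obtain b where b: "b \<in> \<Delta>" using simple_nonempty by blast
  have "\<mu> * (b \<bullet> b) \<le> b \<bullet> b"
    using z(4)[of b] w[OF b span_zero, of 1] b
    by (simp add: \<mu>_def span_base weight_def representation_zero)
  then have \<mu>1: "\<mu> \<le> 1" using simple_inner_pos[OF b] by simp
  define Z where "Z = {a \<in> \<Delta>. 0 < rep z a}"
  have "Z = \<Delta>"
  proof (rule ccontr)
    assume "Z \<noteq> \<Delta>"
    moreover have "Z \<noteq> {}"
    proof
      assume "Z = {}"
      then have "rep z a = 0" if "a \<in> \<Delta>" for a using z(3)[OF that] that by (force simp: Z_def)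
      then have "weight z = 0" by (simp add: weight_def)
      then show False using z(2) by simp
    qed
    ultimately obtain a c where ac: "a \<in> Z" "c \<in> \<Delta> - Z" "a \<bullet> c \<noteq> 0"
      using simple_roots_connected[of Z] by (auto simp: Z_def)
    then have c: "c \<in> \<Delta>" "rep z c = 0" and aD: "a \<in> \<Delta>" "0 < rep z a" "a \<noteq> c"
      using z(3)[of c] by (auto simp: Z_def)
    \<comment> \<open>The eigenvector equation at \<open>c\<close>, where \<open>z\<close> vanishes, is a sum of nonpositive terms.\<close>
    have nonpos: "rep z d * (d \<bullet> c) \<le> 0" if "d \<in> \<Delta>" for d
      using c z(3)[OF that] simple_nonpos_inner[OF that c(1)]
      by (cases "d = c") (auto simp: mult_nonneg_nonpos)
    have "0 = z \<bullet> c" using eig[OF c(1)] c(2) by simp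
    also have "\<dots> = (\<Sum>d\<in>\<Delta>. rep z d *\<^sub>R d) \<bullet> c" using expansion z(1) by simp
    also have "\<dots> = (\<Sum>d\<in>\<Delta>. rep z d * (d \<bullet> c))" by (simp add: inner_sum_left)
    also have "\<dots> \<le> rep z a * (a \<bullet> c)"
      using finite_simple aD(1) nonpos by (subst sum.remove[of _ a]) (auto intro!: sum_nonpos)
    also have "\<dots> < 0"
      using aD ac(3) simple_nonpos_inner[OF aD(1) c(1) aD(3)] by (simp add: mult_pos_neg)
    finally show False by simp
  qed
  then have "0 < rep z b" if "b \<in> \<Delta>" for b using that by (auto simp: Z_def)
  then show ?thesis using z(1) \<mu> \<mu>1 eig by (intro exI[of _ z] exI[of _ \<mu>]) blast
qed


text \<open>
  The map \<open>(f, g)\<close> is the projection to the Coxeter plane in the coordinates where the simple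
  roots of \<open>P\<close> lie on the first axis and those of \<open>N\<close> on the second one. The two products of
  reflections then act by explicit two-by-two matrices, with \<open>l = 2 cos (\<pi> / h)\<close> for the Coxeter
  number \<open>h\<close>. The projection is described by the properties that are used later.
\<close>

definition plane_projection :: "('a \<Rightarrow> real) \<Rightarrow> ('a \<Rightarrow> real) \<Rightarrow> real \<Rightarrow> bool" where
  "plane_projection f g l \<longleftrightarrow>
     0 \<le> l \<and> l < 2 \<and>
     (\<forall>x\<in>pos. 0 \<le> f x \<and> 0 \<le> g x \<and> 0 < f x + g x) \<and>
     (\<forall>x\<in>\<Phi>. f (- x) = - f x \<and> g (- x) = - g x) \<and>
     (\<forall>x\<in>\<Phi>. f (sP x) = - f x + l * g x \<and> g (sP x) = g x) \<and>
     (\<forall>x\<in>\<Phi>. f (sN x) = f x \<and> g (sN x) = - g x + l * f x) \<and>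
     (\<forall>a\<in>P. g a = 0) \<and> (\<forall>a\<in>N. f a = 0)"

text \<open>
  The functionals are the coordinates summed over \<open>P\<close> and over \<open>N\<close> with weights from the
  eigenvector \<open>z\<close>. The change of the first one under \<open>sP\<close> is twice the inner product of \<open>x\<close> with
  the \<open>P\<close>-part of \<open>z\<close>, and the eigenvector equation expresses this inner product by the
  functionals themselves.
\<close>

lemma weighted_coordinates_sP:
  assumes z: "z \<in> span \<Delta>" "\<And>b. b \<in> \<Delta> \<Longrightarrow> z \<bullet> b = \<mu> * ((b \<bullet> b) * rep z b)"
    and x: "x \<in> span \<Delta>"
  shows "(\<Sum>a\<in>P. (a \<bullet> a) * rep z a * rep (sP x) a) =
         - (\<Sum>a\<in>P. (a \<bullet> a) * rep z a * rep x a) + (2 - 2 * \<mu>) * (\<Sum>a\<in>N. (a \<bullet> a) * rep z a * rep x a)"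
    and "(\<Sum>a\<in>N. (a \<bullet> a) * rep z a * rep (sP x) a) = (\<Sum>a\<in>N. (a \<bullet> a) * rep z a * rep x a)"
proof -
  let ?f = "\<lambda>x. \<Sum>a\<in>P. (a \<bullet> a) * rep z a * rep x a"
  let ?g = "\<lambda>x. \<Sum>a\<in>N. (a \<bullet> a) * rep z a * rep x a"
  define zP where "zP = (\<Sum>a\<in>P. rep z a *\<^sub>R a)"
  define zN where "zN = (\<Sum>a\<in>N. rep z a *\<^sub>R a)"
  have z_split: "z = zP + zN"
    using expansion[OF z(1)] P_Un_N P_Int_N finite_P finite_N
    by (simp add: zP_def zN_def sum.union_disjoint)
  have bP: "zP \<bullet> b = (b \<bullet> b) * rep z b" if "b \<in> P" for b
    unfolding zP_def using sum_orthogonal_single[OF finite_P orthogonal_P that] by simp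
  have bN: "zP \<bullet> b = (\<mu> - 1) * ((b \<bullet> b) * rep z b)" if "b \<in> N" for b
  proof -
    have "zN \<bullet> b = rep z b * (b \<bullet> b)"
      unfolding zN_def using sum_orthogonal_single[OF finite_N orthogonal_N that] by simp
    moreover have "zP \<bullet> b + zN \<bullet> b = \<mu> * ((b \<bullet> b) * rep z b)"
      using z(2)[of b] that N_subset z_split by (auto simp: inner_add_left)
    ultimately show ?thesis by (simp add: algebra_simps)
  qed
  have "x \<bullet> zP = zP \<bullet> (\<Sum>b\<in>\<Delta>. rep x b *\<^sub>R b)" using expansion[OF x] by (simp add: inner_commute)
  also have "\<dots> = (\<Sum>b\<in>P. rep x b * (zP \<bullet> b)) + (\<Sum>b\<in>N. rep x b * (zP \<bullet> b))"
    unfolding P_Un_N using P_Int_N finite_P finite_N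
    by (simp add: inner_sum_right inner_add_right sum.union_disjoint)
  also have "\<dots> = ?f x + (\<mu> - 1) * ?g x"
    by (simp add: bP bN sum_distrib_left algebra_simps)
  finally have xz: "x \<bullet> zP = ?f x + (\<mu> - 1) * ?g x" .
  have "?f (sP x) = (\<Sum>a\<in>P. (a \<bullet> a) * rep z a * rep x a - 2 * (rep z a * (x \<bullet> a)))"
  proof (rule sum.cong)
    fix a assume a: "a \<in> P"
    then have "0 < a \<bullet> a" using P_subset simple_inner_pos by auto
    then show "(a \<bullet> a) * rep z a * rep (sP x) a = (a \<bullet> a) * rep z a * rep x a - 2 * (rep z a * (x \<bullet> a))"
      using a by (simp add: rep_sP[OF x] field_simps)
  qed simp
  also have "\<dots> = ?f x - 2 * (x \<bullet> zP)"
    by (simp add: sum_subtractf zP_def inner_sum_right sum_distrib_left)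
  finally show "?f (sP x) = - ?f x + (2 - 2 * \<mu>) * ?g x" using xz by (simp add: algebra_simps)
  show "?g (sP x) = ?g x"
    by (rule sum.cong) (use P_Int_N in \<open>auto simp: rep_sP[OF x]\<close>)
qed

lemmas weighted_coordinates_sN = bipartite_roots.weighted_coordinates_sP[OF swap]

lemma plane_projection_exists: "\<exists>f g l. plane_projection f g l"
proof -
  obtain z \<mu> where z: "z \<in> span \<Delta>" "0 < \<mu>" "\<mu> \<le> 1" "\<And>b. b \<in> \<Delta> \<Longrightarrow> 0 < rep z b"
    "\<And>b. b \<in> \<Delta> \<Longrightarrow> z \<bullet> b = \<mu> * ((b \<bullet> b) * rep z b)"
    using perron_frobenius by blast
  define F where "F J x = (\<Sum>a\<in>J. (a \<bullet> a) * rep z a * rep x a)" for J x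
  have w: "0 < (a \<bullet> a) * rep z a" if "a \<in> \<Delta>" for a
    using that z(4) simple_inner_pos by simp
  have nonneg: "0 \<le> F J x" if "x \<in> pos" "J \<subseteq> \<Delta>" for J x
    unfolding F_def using that w rep_pos[OF that(1)]
    by (intro sum_nonneg mult_nonneg_nonneg[OF less_imp_le]) auto
  have total: "0 < F P x + F N x" if "x \<in> pos" for x
  proof -
    obtain a where a: "a \<in> \<Delta>" "0 < rep x a" using rep_pos_ex \<open>x \<in> pos\<close> by blast
    have "F P x + F N x = F \<Delta> x"
      unfolding F_def P_Un_N using P_Int_N finite_P finite_N by (simp add: sum.union_disjoint)
    moreover have "0 < F \<Delta> x"
      unfolding F_def
    proof (rule sum_pos2[OF finite_simple a(1)])
      show "0 < (a \<bullet> a) * rep z a * rep x a" using w a by simp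
      show "0 \<le> (b \<bullet> b) * rep z b * rep x b" if "b \<in> \<Delta>" for b
        using mult_nonneg_nonneg[OF less_imp_le[OF w[OF that]] rep_pos[OF \<open>x \<in> pos\<close> that]] .
    qed
    ultimately show ?thesis by simp
  qed
  have neg: "F J (- x) = - F J x" if "x \<in> \<Phi>" for J x
    using that by (simp add: F_def rep_minus root_span sum_negf)
  have zero: "F J a = 0" if "a \<in> \<Delta>" "a \<notin> J" for J a
    unfolding F_def using that by (intro sum.neutral) (auto simp: rep_simple)
  have zeros: "F N a = 0" if "a \<in> P" for a
    using that zero[of a N] P_subset P_Int_N by blast
  have zeros': "F P a = 0" if "a \<in> N" for a
    using that zero[of a P] N_subset P_Int_N by blast
  have "plane_projection (F P) (F N) (2 - 2 * \<mu>)"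
    unfolding plane_projection_def
    using z(1-3) nonneg total neg zeros zeros' P_subset N_subset
      weighted_coordinates_sP[OF z(1,5) root_span] weighted_coordinates_sN[OF z(1,5) root_span]
    by (auto simp: F_def[symmetric])
  then show ?thesis by blast
qed

section \<open>The rotation of almost positive roots\<close>

abbreviation R :: "'a \<Rightarrow> 'a" where "R \<equiv> rot P N"

definition cox :: "'a \<Rightarrow> 'a" where "cox x = sN (sP x)"

lemma cox_root: "x \<in> \<Phi> \<Longrightarrow> cox x \<in> \<Phi>"
  by (simp add: cox_def sP_root sN_root)

lemma cox_pow_root: "x \<in> \<Phi> \<Longrightarrow> (cox ^^ k) x \<in> \<Phi>"
  by (induction k) (simp_all add: cox_root)

lemma inj_cox: "inj cox"
  by (rule injI) (metis cox_def sN_sN sP_sP)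

lemma tau_P: "tau P N x = (if x \<in> uminus ` N then x else sP x)"
  by (simp add: tau_def fold_refl_root finite_P orthogonal_P)

lemma tau_N: "tau N P x = (if x \<in> uminus ` P then x else sN x)"
  by (simp add: tau_def fold_refl_root finite_N orthogonal_N)

lemma pos_not_neg_simple: "x \<in> pos \<Longrightarrow> x \<notin> uminus ` \<Delta>"
  using not_pos_neg simple_pos by force

lemma pos_not_neg_P: "x \<in> pos \<Longrightarrow> x \<notin> uminus ` P"
  and pos_not_neg_N: "x \<in> pos \<Longrightarrow> x \<notin> uminus ` N"
  using pos_not_neg_simple P_subset N_subset by blast+

lemma almost_pos_cases:
  assumes "x \<in> almost_pos"
  obtains "x \<in> pos" | a where "a \<in> \<Delta>" "x = - a"
  using assms by (auto simp: almost_positive_roots_def)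

lemma pos_almost_pos: "x \<in> pos \<Longrightarrow> x \<in> almost_pos"
  and neg_almost_pos: "a \<in> \<Delta> \<Longrightarrow> - a \<in> almost_pos"
  by (auto simp: almost_positive_roots_def)

lemma neg_not_pos: "a \<in> \<Delta> \<Longrightarrow> - a \<notin> pos"
  using not_pos_neg simple_pos by blast

lemma almost_pos_neg_iff: "x \<in> almost_pos \<Longrightarrow> - x \<in> pos \<longleftrightarrow> x \<notin> pos"
  by (erule almost_pos_cases) (auto simp: not_pos_neg neg_not_pos simple_pos)

lemma finite_almost_pos: "finite almost_pos"
proof -
  have "pos \<subseteq> \<Phi>" using pos_root by blast
  then show ?thesis
    using finite_roots finite_simple by (auto simp: almost_positive_roots_def intro: finite_subset)
qed

lemma tau_P_involution:
  assumes "x \<in> almost_pos"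
  shows "tau P N x \<in> almost_pos \<and> tau P N (tau P N x) = x"
  using assms
proof (cases rule: almost_pos_cases)
  case 1
  show ?thesis
  proof (cases "x \<in> P")
    case True
    then have "- x \<notin> uminus ` N" using P_Int_N by auto
    with True 1 show ?thesis
      using P_subset
      by (auto simp: tau_P pos_not_neg_N sP_simple refl_prod_minus neg_almost_pos subset_iff)
  next
    case False
    then show ?thesis
      using 1 sP_pos[OF 1 False] by (simp add: tau_P pos_not_neg_N sP_sP pos_almost_pos)
  qed
next
  case (2 a)
  show ?thesis
  proof (cases "a \<in> P")
    case True
    then have "- a \<notin> uminus ` N" using P_Int_N by auto
    with True 2 show ?thesis
      by (simp add: tau_P sP_simple refl_prod_minus pos_not_neg_N simple_pos pos_almost_pos)
  next
    case False
    then have "x \<in> uminus ` N" using 2 P_Un_N by auto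
    then show ?thesis using assms by (simp add: tau_P)
  qed
qed

lemmas tau_N_involution = bipartite_roots.tau_P_involution[OF swap]

lemma R_almost_pos: "x \<in> almost_pos \<Longrightarrow> R x \<in> almost_pos"
  using tau_P_involution tau_N_involution by (simp add: rot_def)

lemma R_inj: "inj_on R almost_pos"
  unfolding rot_def o_def
  by (rule inj_onI) (metis tau_P_involution tau_N_involution)

lemma R_pow_almost_pos: "x \<in> almost_pos \<Longrightarrow> (R ^^ k) x \<in> almost_pos"
  by (induction k) (simp_all add: R_almost_pos)

text \<open>
  Vectors that make the rotation linear: on them \<open>R\<close> acts as \<open>cox\<close> at positive roots and as
  negation at negative simple roots. For simply laced diagrams \<open>- root_class (- a)\<close> is the class
  of the indecomposable projective quiver representation that belongs to \<open>a\<close>, for the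
  orientation in which the vertices in \<open>N\<close> are sinks.
\<close>

definition root_class :: "'a \<Rightarrow> 'a" where
  "root_class x = (if x \<in> uminus ` P then sN x else x)"

lemma root_class_pos: "x \<in> pos \<Longrightarrow> root_class x = x"
  by (simp add: root_class_def pos_not_neg_P)

lemma root_class_R_pos:
  assumes x: "x \<in> pos"
  shows "root_class (R x) = cox x"
proof (cases "x \<in> P")
  case True
  then have "R x = - x"
    using x by (simp add: rot_def tau_P tau_N pos_not_neg_N sP_simple)
  then show ?thesis using True by (simp add: root_class_def cox_def sP_simple)
next
  case False
  have y: "sP x \<in> pos" "sP x \<notin> P" using sP_pos x False by auto
  then have "R x = cox x"
    using x by (simp add: rot_def tau_P tau_N pos_not_neg_N pos_not_neg_P cox_def)
  moreover have "cox x \<notin> uminus ` P"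
  proof (cases "sP x \<in> N")
    case True
    then show ?thesis using P_Int_N by (auto simp: cox_def sN_simple)
  next
    case False
    then show ?thesis using sN_pos y pos_not_neg_P by (simp add: cox_def)
  qed
  ultimately show ?thesis by (simp add: root_class_def)
qed

lemma root_class_neg_P: "a \<in> P \<Longrightarrow> root_class (- a) = - sN a"
  by (simp add: root_class_def refl_prod_minus)

lemma root_class_neg_N: "a \<in> N \<Longrightarrow> root_class (- a) = - a"
  using P_Int_N by (auto simp: root_class_def)

lemma R_neg_P: assumes a: "a \<in> P" shows "R (- a) = sN a" "sN a \<in> pos"
proof -
  have "a \<notin> N" "a \<in> \<Delta>" "- a \<notin> uminus ` N" using a P_Int_N P_subset by auto
  then show "R (- a) = sN a" "sN a \<in> pos"
    using a sN_pos simple_pos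
    by (simp_all add: rot_def tau_P tau_N sP_simple refl_prod_minus pos_not_neg_P)
qed

lemma R_neg_N: assumes a: "a \<in> N" shows "R (- a) = a"
proof -
  have "- a \<in> uminus ` N" "- a \<notin> uminus ` P" using a P_Int_N by auto
  then show ?thesis using a by (simp add: rot_def tau_P tau_N sN_simple refl_prod_minus)
qed

lemma R_neg:
  assumes "a \<in> \<Delta>"
  shows "R (- a) \<in> pos" "root_class (R (- a)) = - root_class (- a)"
proof -
  have "R (- a) \<in> pos \<and> R (- a) = - root_class (- a)"
    using assms P_Un_N R_neg_P R_neg_N root_class_neg_P root_class_neg_N simple_pos by (cases "a \<in> P") auto
  then show "R (- a) \<in> pos" "root_class (R (- a)) = - root_class (- a)" using root_class_pos by metis+
qed

lemma root_class_pos_iff: "x \<in> almost_pos \<Longrightarrow> root_class x \<in> pos \<longleftrightarrow> x \<in> pos"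
  by (erule almost_pos_cases) (use R_neg root_class_pos neg_not_pos not_pos_neg in force)+

section \<open>Depth\<close>

abbreviation D :: "'a \<Rightarrow> nat" where "D \<equiv> depth \<Phi> \<Delta> P N"

text \<open>
  By the Cayley-Hamilton theorem on the Coxeter plane, \<open>h (cox y) + h w\<close> with \<open>y = cox w\<close> equals
  \<open>(l\<^sup>2 - 2) * h y\<close>, which is less than \<open>2 * h y\<close>. So \<open>h\<close> has no positive minimum on a set on
  which \<open>cox\<close> acts as a permutation, such as the set of roots whose orbits stay positive.
\<close>

lemma leaves_positive:
  assumes "x \<in> pos"
  shows "\<exists>k. (cox ^^ k) x \<notin> pos"
proof (rule ccontr)
  obtain f g l where fg: "plane_projection f g l" using plane_projection_exists by blast
  define S where "S = {y. \<forall>k. (cox ^^ k) y \<in> pos}"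
  assume "\<not> ?thesis"
  then have "S \<noteq> {}" by (auto simp: S_def)
  have S_pos: "y \<in> pos" if "y \<in> S" for y
    using that unfolding S_def by (metis (mono_tags) funpow_0 mem_Collect_eq)
  then have S_fin: "finite S" using finite_roots pos_root by (auto intro: finite_subset)
  have "(cox ^^ k) (cox y) \<in> pos" if "y \<in> S" for y k
  proof -
    have "(cox ^^ Suc k) y \<in> pos" using that unfolding S_def by blast
    then show ?thesis by (simp add: funpow_swap1)
  qed
  then have sub: "cox ` S \<subseteq> S" by (auto simp: S_def)
  have onto: "cox ` S = S"
    using S_fin sub inj_cox by (intro endo_inj_surj) (auto intro: inj_on_subset)
  define h where "h y = f y + g y" for y
  obtain y where y: "y \<in> S" "\<And>w. w \<in> S \<Longrightarrow> h y \<le> h w"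
    using arg_min_least[OF S_fin \<open>S \<noteq> {}\<close>, where f = h] arg_min_if_finite(1)[OF S_fin \<open>S \<noteq> {}\<close>, of h] by blast
  obtain w where w: "w \<in> S" "y = cox w" using onto y(1) by blast
  have wr: "w \<in> \<Phi>" "y \<in> \<Phi>" using w y S_pos pos_root by auto
  have step: "f (cox v) = - f v + l * g v" "g (cox v) = - g v + l * (- f v + l * g v)" if "v \<in> \<Phi>" for v
    using fg that by (simp_all add: plane_projection_def cox_def sP_root)
  have "h (cox y) + h w = (l\<^sup>2 - 2) * h y"
    unfolding h_def step[OF wr(2)] unfolding w(2) step[OF wr(1)]
    by (simp add: power2_eq_square algebra_simps)
  moreover have "h y \<le> h (cox y)" "h y \<le> h w" using y w sub by auto
  moreover have h: "0 < h y" using fg S_pos[OF y(1)] by (simp add: plane_projection_def h_def)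
  moreover have "l\<^sup>2 - 2 < 2"
    using fg power_strict_mono[of l 2 2] by (simp add: plane_projection_def)
  then have "(l\<^sup>2 - 2) * h y < 2 * h y" using h by (rule mult_strict_right_mono)
  ultimately show False by linarith
qed

definition exit_time :: "'a \<Rightarrow> nat" where
  "exit_time x = (LEAST k. (cox ^^ k) x \<notin> pos)"

lemma root_class_R_pow:
  assumes "x \<in> pos" "\<And>j. j < k \<Longrightarrow> (R ^^ j) x \<in> pos"
  shows "root_class ((R ^^ k) x) = (cox ^^ k) x"
  using assms(2)
proof (induction k)
  case 0
  then show ?case using assms(1) by (simp add: root_class_pos)
next
  case (Suc k)
  then have "(R ^^ k) x \<in> pos" by simp
  moreover have "root_class ((R ^^ k) x) = (cox ^^ k) x" using Suc by simp
  ultimately show ?case using root_class_R_pos[of "(R ^^ k) x"] by (simp add: root_class_pos)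
qed

lemma depth_eq_exit_time:
  assumes x: "x \<in> pos"
  shows "D x = exit_time x" "- ((R ^^ D x) x) \<in> pos"
proof -
  let ?e = "exit_time x"
  have ap: "(R ^^ k) x \<in> almost_pos" for k using x by (simp add: R_pow_almost_pos pos_almost_pos)
  have e: "(cox ^^ ?e) x \<notin> pos" "\<And>k. k < ?e \<Longrightarrow> (cox ^^ k) x \<in> pos"
    unfolding exit_time_def using LeastI_ex[OF leaves_positive[OF x]] not_less_Least by blast+
  have below: "(R ^^ k) x \<in> pos" if "k < ?e" for k
    using that
  proof (induction k rule: less_induct)
    case (less k)
    then have "root_class ((R ^^ k) x) = (cox ^^ k) x" by (intro root_class_R_pow x) auto
    then show ?case using e(2) less.prems root_class_pos_iff[OF ap] by metis
  qed
  have "(R ^^ ?e) x \<notin> pos"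
    using root_class_R_pow[OF x below] e(1) root_class_pos_iff[OF ap] by metis
  then have at: "- ((R ^^ ?e) x) \<in> pos" using almost_pos_neg_iff ap by blast
  show "D x = ?e"
    unfolding depth_def
  proof (rule Least_equality)
    show "- ((R ^^ ?e) x) \<in> pos" by (rule at)
    fix k assume "- ((R ^^ k) x) \<in> pos"
    then show "?e \<le> k" using below not_pos_neg not_less by blast
  qed
  then show "- ((R ^^ D x) x) \<in> pos" using at by simp
qed

lemma depth_neg: "a \<in> \<Delta> \<Longrightarrow> D (- a) = 0"
  unfolding depth_def by (rule Least_equality) (simp_all add: simple_pos)

lemma depth_pos:
  assumes "x \<in> pos"
  shows "D x = Suc (D (R x))"
proof -
  have "\<not> - ((R ^^ 0) x) \<in> pos" using assms not_pos_neg by simp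
  from Least_Suc[of "\<lambda>d. - ((R ^^ d) x) \<in> pos", OF depth_eq_exit_time(2)[OF assms] this]
  show ?thesis by (simp add: depth_def funpow_swap1)
qed


text \<open>
  The value at \<open>Suc n\<close> is \<open>U\<^sub>n (l / 2)\<close>, with \<open>U\<^sub>n\<close> the Chebyshev polynomial of the second
  kind.
\<close>

fun cheb :: "real \<Rightarrow> nat \<Rightarrow> real" where
  "cheb l 0 = 0"
| "cheb l (Suc 0) = 1"
| "cheb l (Suc (Suc n)) = l * cheb l (Suc n) - cheb l n"

text \<open>
  The points with consecutive Chebyshev values as coordinates lie on the rays through which a simple
  root passes, and \<open>cox\<close> advances by two of them: the index is even for orbits that start in \<open>N\<close>
  and odd for orbits that start at \<open>sN a\<close> with \<open>a\<close> in \<open>P\<close>.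
\<close>

lemma cox_pow_projection:
  assumes fg: "plane_projection f g l" and x: "x \<in> \<Phi>"
    and "f x = r * cheb l t" "g x = r * cheb l (Suc t)"
  shows "f ((cox ^^ k) x) = r * cheb l (2 * k + t) \<and> g ((cox ^^ k) x) = r * cheb l (Suc (2 * k + t))"
proof (induction k)
  case 0
  then show ?case using assms by simp
next
  case (Suc k)
  let ?y = "(cox ^^ k) x"
  have y: "?y \<in> \<Phi>" using x by (rule cox_pow_root)
  have "f (cox ?y) = - f ?y + l * g ?y" "g (cox ?y) = - g ?y + l * (- f ?y + l * g ?y)"
    using fg y by (simp_all add: plane_projection_def cox_def sP_root)
  then show ?case using Suc by (simp add: algebra_simps)
qed

lemma pos_iff_projection:
  assumes fg: "plane_projection f g l" and x: "x \<in> \<Phi>"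
  shows "x \<in> pos \<longleftrightarrow> 0 \<le> f x \<and> 0 \<le> g x"
    and "x \<notin> pos \<Longrightarrow> f x \<le> 0 \<and> g x \<le> 0 \<and> (f x < 0 \<or> g x < 0)"
proof -
  show neg: "f x \<le> 0 \<and> g x \<le> 0 \<and> (f x < 0 \<or> g x < 0)" if "x \<notin> pos"
  proof -
    have "- x \<in> pos" using that pos_or_neg x by blast
    then have "0 \<le> f (- x)" "0 \<le> g (- x)" "0 < f (- x) + g (- x)"
      using fg by (auto simp: plane_projection_def)
    then show ?thesis using fg x by (auto simp: plane_projection_def)
  qed
  show "x \<in> pos \<longleftrightarrow> 0 \<le> f x \<and> 0 \<le> g x"
    using neg fg unfolding plane_projection_def by force
qed

text \<open>
  Call \<open>t\<close> bad if the ray with index \<open>t\<close> is not in the positive quadrant. An exit time is the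
  least \<open>k\<close> for which \<open>2 * k\<close> (for \<open>N\<close>) or \<open>2 * k + 1\<close> (for \<open>P\<close>) is bad. A bad index has a
  bad neighbor: if \<open>t\<close> is not bad but \<open>Suc t\<close> is, their common coordinate is zero, so the other
  coordinate of \<open>Suc t\<close> is negative, and it is also a coordinate of \<open>Suc (Suc t)\<close>. Hence the two
  parities are compared by passing from a bad index to a bad neighbor.
\<close>

lemma exit_times:
  assumes a: "a \<in> \<Delta>" and b: "b \<in> \<Delta>"
  shows "exit_time (R (- b)) \<le> exit_time (R (- a)) \<or>
    (a \<in> P \<and> b \<in> N \<and> exit_time (R (- b)) = Suc (exit_time (R (- a))))"
proof -
  obtain f g l where fg: "plane_projection f g l" using plane_projection_exists by blast
  define bad where "bad t \<longleftrightarrow> \<not> (0 \<le> cheb l t \<and> 0 \<le> cheb l (Suc t))" for t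
  have coherent: "\<exists>r > 0. f ((cox ^^ k) (R (- c))) = r * cheb l (2 * k + (if c \<in> P then 1 else 0))
      \<and> g ((cox ^^ k) (R (- c))) = r * cheb l (Suc (2 * k + (if c \<in> P then 1 else 0)))"
    if c: "c \<in> \<Delta>" for c k
  proof (cases "c \<in> P")
    case True
    have "f c > 0" using fg True simple_pos[OF c] by (force simp: plane_projection_def)
    moreover have "f (sN c) = f c * cheb l 1 \<and> g (sN c) = f c * cheb l (Suc 1)"
      using fg True simple_root[OF c] by (simp add: plane_projection_def)
    ultimately show ?thesis
      using True cox_pow_projection[OF fg, of "sN c" "f c" 1 k] R_neg_P[OF True] pos_root
      by (intro exI[of _ "f c"]) auto
  next
    case False
    then have N: "c \<in> N" using c P_Un_N by auto
    have "g c > 0" using fg N simple_pos[OF c] by (force simp: plane_projection_def)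
    moreover have "f c = g c * cheb l 0 \<and> g c = g c * cheb l (Suc 0)"
      using fg N by (simp add: plane_projection_def)
    ultimately show ?thesis
      using False cox_pow_projection[OF fg, of c "g c" 0 k] R_neg_N[OF N] simple_root[OF c]
      by (intro exI[of _ "g c"]) auto
  qed
  have root: "(cox ^^ k) (R (- c)) \<in> \<Phi>" if "c \<in> \<Delta>" for c k
    using R_neg(1)[OF that] pos_root cox_pow_root by blast
  have bad_iff: "(cox ^^ k) (R (- c)) \<notin> pos \<longleftrightarrow> bad (2 * k + (if c \<in> P then 1 else 0))"
    if c: "c \<in> \<Delta>" for c k
    using coherent[OF c, of k] pos_iff_projection(1)[OF fg root[OF c, of k]]
    by (auto simp: bad_def zero_le_mult_iff)
  have strict: "cheb l t \<le> 0 \<and> cheb l (Suc t) \<le> 0 \<and> (cheb l t < 0 \<or> cheb l (Suc t) < 0)"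
    if "bad t" "c \<in> \<Delta>" "t = 2 * k + (if c \<in> P then 1 else 0)" for t c k
  proof -
    have "(cox ^^ k) (R (- c)) \<notin> pos" using bad_iff[OF that(2)] that by simp
    from pos_iff_projection(2)[OF fg root[OF that(2)] this] coherent[OF that(2), of k]
    show ?thesis by (auto simp: that(3) mult_le_0_iff mult_less_0_iff)
  qed
  have exit: "exit_time (R (- c)) = (LEAST k. bad (2 * k + (if c \<in> P then 1 else 0)))"
    if "c \<in> \<Delta>" for c
    unfolding exit_time_def bad_iff[OF that] ..
  have ex: "bad (2 * exit_time (R (- c)) + (if c \<in> P then 1 else 0))" if "c \<in> \<Delta>" for c
  proof -
    have "\<exists>k. bad (2 * k + (if c \<in> P then 1 else 0))"
      using leaves_positive[OF R_neg(1)[OF that]] bad_iff[OF that] by blast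
    then show ?thesis unfolding exit[OF that] by (rule LeastI_ex)
  qed
  have least: "exit_time (R (- c)) \<le> k" if "c \<in> \<Delta>" "bad (2 * k + (if c \<in> P then 1 else 0))" for c k
    unfolding exit[OF that(1)] using that(2) by (rule Least_le)
  have step: "bad t \<or> bad (Suc (Suc t))"
    if "bad (Suc t)" "c \<in> \<Delta>" "Suc t = 2 * k + (if c \<in> P then 1 else 0)" for t c k
    using strict[OF that] by (auto simp: bad_def simp del: cheb.simps)
  consider "a \<in> P \<longleftrightarrow> b \<in> P" | "a \<in> P" "b \<notin> P" "b \<in> N" | "a \<notin> P" "b \<in> P"
    using a b P_Un_N by blast
  then show ?thesis
  proof cases
    case 1
    then show ?thesis using exit[OF a] exit[OF b] by simp
  next
    case 2
    define k where "k = exit_time (R (- a))"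
    have eq: "Suc (2 * k) = 2 * k + (if a \<in> P then 1 else 0)" using 2 by simp
    have "bad (Suc (2 * k))" using ex[OF a] 2(1) by (simp add: k_def)
    from step[OF this a eq] have "exit_time (R (- b)) \<le> Suc k"
    proof
      assume "bad (2 * k)"
      then have "exit_time (R (- b)) \<le> k" using 2(2) by (intro least b) simp
      then show ?thesis by simp
    next
      assume "bad (Suc (Suc (2 * k)))"
      then show ?thesis using 2(2) by (intro least b) simp
    qed
    then show ?thesis using 2 unfolding k_def by auto
  next
    case 3
    define k where "k = exit_time (R (- a))"
    have bad: "bad (2 * k)" using ex[OF a] 3(1) by (simp add: k_def)
    then have "k \<noteq> 0" by (cases k) (auto simp: bad_def)
    then obtain j where j: "k = Suc j" using not0_implies_Suc by blast
    have eq: "Suc (Suc (2 * j)) = 2 * k + (if a \<in> P then 1 else 0)" using 3 j by simp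
    have "bad (Suc (Suc (2 * j)))" using bad j by simp
    from step[OF this a eq] have "exit_time (R (- b)) \<le> k"
    proof
      assume "bad (Suc (2 * j))"
      then have "exit_time (R (- b)) \<le> j" using 3(2) by (intro least b) simp
      then show ?thesis using j by simp
    next
      assume "bad (Suc (Suc (Suc (2 * j))))"
      then show ?thesis using 3(2) j by (intro least b) simp
    qed
    then show ?thesis unfolding k_def by simp
  qed
qed

text \<open>
  Since \<open>R\<close> permutes the almost positive roots, \<open>y\<close> can be followed backwards. The depth grows
  by one in each step that stays positive, and it is bounded, so a negative simple root is reached.
\<close>

lemma pos_from_simple:
  assumes "y \<in> pos"
  shows "\<exists>a\<in>\<Delta>. y = R (- a) \<or> D y < D (R (- a))"
proof -
  define M where "M = Max (D ` pos)"
  have fin: "finite pos" using finite_roots pos_root by (auto intro: finite_subset)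
  have M: "D w \<le> M" if "w \<in> pos" for w
    unfolding M_def using that fin by (intro Max_ge) auto
  have onto: "R ` almost_pos = almost_pos"
    using finite_almost_pos R_almost_pos R_inj by (intro endo_inj_surj) auto
  show ?thesis
    using assms
  proof (induction "M - D y" arbitrary: y rule: less_induct)
    case less
    then obtain w where w: "w \<in> almost_pos" "y = R w" using onto pos_almost_pos by blast
    from w(1) show ?case
    proof (cases rule: almost_pos_cases)
      case 1
      then have d: "D w = Suc (D y)" using depth_pos w by simp
      then have "M - D w < M - D y" using M[OF 1] by simp
      from less.hyps[OF this 1] show ?thesis using d by force
    next
      case (2 a)
      then show ?thesis using w by blast
    qed
  qed
qed

text \<open>
  The run of positive roots through \<open>y\<close> starts at some \<open>R (- b)\<close> and is at most one longer than the
  run that starts at \<open>R (- a)\<close>. So \<open>y\<close> is the very first root of its run, and this run is of the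
  longer kind.
\<close>

lemma depth_overshoot:
  assumes y: "y \<in> pos" and a: "a \<in> \<Delta>" and "D (R (- a)) < D y"
  shows "a \<in> P" "y \<in> N" "D y = Suc (D (R (- a)))"
proof -
  obtain b where b: "b \<in> \<Delta>" "y = R (- b) \<or> D y < D (R (- b))" using pos_from_simple[OF y] by blast
  have "D (R (- b)) \<le> D (R (- a)) \<or> (a \<in> P \<and> b \<in> N \<and> D (R (- b)) = Suc (D (R (- a))))"
    using exit_times[OF a b(1)] depth_eq_exit_time(1)[OF R_neg(1)] a b(1) by simp
  then have "a \<in> P \<and> b \<in> N \<and> D (R (- b)) = Suc (D (R (- a))) \<and> y = R (- b)"
    using b(2) assms(3) by auto
  then show "a \<in> P" "y \<in> N" "D y = Suc (D (R (- a)))" using R_neg_N by auto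
qed

section \<open>The Euler form and compatibility\<close>

definition part :: "'a set \<Rightarrow> 'a \<Rightarrow> 'a" where
  "part J x = (\<Sum>a\<in>J. rep x a *\<^sub>R a)"

text \<open>
  The Euler form of the quiver obtained by orienting the diagram from \<open>P\<close> to \<open>N\<close>, scaled so
  that its symmetrization is twice the inner product.
\<close>

definition euler :: "'a \<Rightarrow> 'a \<Rightarrow> real" where
  "euler x y = part P x \<bullet> part P y + part N x \<bullet> part N y + 2 * (part P x \<bullet> part N y)"

lemma part_sum: "x \<in> span \<Delta> \<Longrightarrow> x = part P x + part N x"
  using expansion[of x] sum.union_disjoint[OF finite_P finite_N P_Int_N, of "\<lambda>a. rep x a *\<^sub>R a"]
  by (simp add: part_def flip: P_Un_N)

lemma part_sP:
  assumes x: "x \<in> span \<Delta>"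
  shows "part N (sP x) = part N x"
    and "part P (sP x) \<bullet> part P y = - (part P x \<bullet> part P y) - 2 * (part N x \<bullet> part P y)"
proof -
  show "part N (sP x) = part N x"
    unfolding part_def by (rule sum.cong) (use P_Int_N in \<open>auto simp: rep_sP[OF x]\<close>)
  define q where "q = (\<Sum>a\<in>P. (2 * (x \<bullet> a) / (a \<bullet> a)) *\<^sub>R a)"
  have "part P (sP x) = part P x - q"
    unfolding part_def q_def sum_subtractf[symmetric]
    by (rule sum.cong) (auto simp: rep_sP[OF x] algebra_simps)
  moreover have "q \<bullet> part P y = 2 * (x \<bullet> part P y)"
  proof -
    have "q \<bullet> a = 2 * (x \<bullet> a)" if "a \<in> P" for a
      unfolding q_def using sum_orthogonal_single[OF finite_P orthogonal_P that]
        simple_inner_pos[of a] P_subset that by auto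
    then show ?thesis by (simp add: part_def inner_sum_right sum_distrib_left algebra_simps)
  qed
  moreover have "x \<bullet> part P y = part P x \<bullet> part P y + part N x \<bullet> part P y"
    by (subst part_sum[OF x]) (simp add: inner_add_left)
  ultimately show "part P (sP x) \<bullet> part P y = - (part P x \<bullet> part P y) - 2 * (part N x \<bullet> part P y)"
    by (simp add: inner_diff_left)
qed

lemmas part_sN = bipartite_roots.part_sP[OF swap]

lemma euler_sN:
  assumes "x \<in> span \<Delta>"
  shows "euler (sN x) y = part P x \<bullet> part P y - part N x \<bullet> part N y"
  using part_sN[OF assms] by (simp add: euler_def)

lemma euler_sP:
  assumes "y \<in> span \<Delta>"
  shows "euler x (sP y) = part N x \<bullet> part N y - part P x \<bullet> part P y"
  using part_sP(1)[OF assms] part_sP(2)[OF assms, of x] by (simp add: euler_def inner_commute)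

text \<open>
  This is Serre duality. Each of the two reflection products turns \<open>E\<close> into the same symmetric
  form up to sign, once in the first and once in the second argument.
\<close>

lemma euler_serre:
  assumes x: "x \<in> span \<Delta>" and y: "y \<in> span \<Delta>"
  shows "euler (cox x) y = - euler y x"
proof -
  have "euler (cox x) y = euler (sN y) (sP x)"
    using euler_sN[OF sP_span[OF x], of y] euler_sN[OF y, of "sP x"]
    by (simp add: cox_def inner_commute)
  also have "\<dots> = - euler (sN (sN y)) x"
    using euler_sP[OF x, of "sN y"] euler_sN[OF sN_span[OF y], of x] by simp
  finally show ?thesis by (simp add: sN_sN)
qed

lemma euler_cox:
  assumes "x \<in> \<Phi>" "y \<in> \<Phi>"
  shows "euler (cox x) (cox y) = euler x y"
  using assms euler_serre[of x "cox y"] euler_serre[of y x] cox_root root_span by simp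

lemma euler_minus_left: "x \<in> span \<Delta> \<Longrightarrow> euler (- x) y = - euler x y"
  by (simp add: euler_def part_def rep_minus sum_negf)

lemma euler_minus_right: "y \<in> span \<Delta> \<Longrightarrow> euler x (- y) = - euler x y"
  by (simp add: euler_def part_def rep_minus sum_negf)

text \<open>
  The Euler form against a projective representation reads off a coefficient of the simple root
  expansion.
\<close>

lemma euler_neg_simple:
  assumes a: "a \<in> \<Delta>" and y: "y \<in> span \<Delta>"
  shows "euler (root_class (- a)) y = - ((a \<bullet> a) * rep y a)"
proof -
  have pa: "part J a = (if a \<in> J then a else 0)" if "finite J" for J
  proof -
    have "part J a = (\<Sum>b\<in>J. if b = a then a else 0)"
      unfolding part_def by (rule sum.cong) (auto simp: rep_simple[OF a])
    then show ?thesis using that by simp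
  qed
  have ap: "part J y \<bullet> a = (a \<bullet> a) * rep y a"
    if "finite J" "pairwise orthogonal J" "a \<in> J" for J
    unfolding part_def using sum_orthogonal_single[OF that] by simp
  show ?thesis
  proof (cases "a \<in> P")
    case True
    then have "a \<notin> N" using P_Int_N by auto
    then show ?thesis
      using True euler_sN[OF span_base[OF a], of y] ap[OF finite_P orthogonal_P True]
      by (simp add: root_class_neg_P euler_minus_left sN_span span_base a pa finite_P finite_N inner_commute)
  next
    case False
    then have "a \<in> N" using a P_Un_N by auto
    then show ?thesis
      using False ap[OF finite_N orthogonal_N \<open>a \<in> N\<close>]
      by (simp add: root_class_neg_N euler_minus_left span_base a)
        (simp add: euler_def pa finite_P finite_N inner_commute)
  qed
qed


lemma almost_pos_root: "x \<in> almost_pos \<Longrightarrow> x \<in> \<Phi>"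
  by (erule almost_pos_cases) (simp_all add: pos_root uminus_root simple_root)

lemma root_class_root: "x \<in> almost_pos \<Longrightarrow> root_class x \<in> \<Phi>"
  by (simp add: root_class_def almost_pos_root sN_root)

lemma return_times:
  assumes "a \<in> \<Delta>" "b \<in> \<Delta>" "D (R (- a)) < D (R (- b))"
  shows "a \<in> P" "b \<in> N"
  using exit_times[OF assms(1,2)] depth_eq_exit_time(1)[OF R_neg(1)] assms by auto

text \<open>
  The Euler form is evaluated with the root of smaller depth in the first place. For
  representations the sum of the two extension groups then has only this one contribution, which is
  why a single equation suffices.
\<close>

definition compat :: "('a \<times> 'a) set" where
  "compat = {(x, y). x \<in> almost_pos \<and> y \<in> almost_pos \<and>
     (D x = D y \<and> x \<noteq> y \<or> D y < D x \<and> euler (root_class y) (root_class x) = 0 \<or>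
      D x < D y \<and> euler (root_class x) (root_class y) = 0)}"

lemma compat_sym: "(x, y) \<in> compat \<longleftrightarrow> (y, x) \<in> compat"
  by (auto simp: compat_def)

lemma compat_neg_pos:
  assumes a: "a \<in> \<Delta>" and y: "y \<in> pos"
  shows "(- a, y) \<in> compat \<longleftrightarrow> rep y a = 0"
proof -
  have "D (- a) = 0" "0 < D y" using depth_neg[OF a] depth_pos[OF y] by simp_all
  then show ?thesis
    using a y euler_neg_simple[OF a root_span[OF pos_root[OF y]]] root_nonzero[OF simple_root[OF a]]
    by (simp add: compat_def neg_almost_pos pos_almost_pos root_class_pos)
qed

lemma compat_neg_neg: "a \<in> \<Delta> \<Longrightarrow> b \<in> \<Delta> \<Longrightarrow> (- a, - b) \<in> compat \<longleftrightarrow> a \<noteq> b"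
  by (simp add: compat_def neg_almost_pos depth_neg)

text \<open>
  Rotation of \<open>- a\<close> reverses which of the two roots is deeper. It negates the class of \<open>- a\<close> and
  applies \<open>cox\<close> to that of \<open>y\<close>, so \<open>euler_serre\<close> restores the original value of the form. The
  exception is the case of \<open>depth_overshoot\<close>, where both sides are true.
\<close>

lemma compat_R_neg_pos:
  assumes a: "a \<in> \<Delta>" and y: "y \<in> pos"
  shows "(- a, y) \<in> compat \<longleftrightarrow> (R (- a), R y) \<in> compat"
proof -
  have ap: "R (- a) \<in> almost_pos" "R y \<in> almost_pos"
    using a y by (simp_all add: R_almost_pos neg_almost_pos pos_almost_pos)
  have dy: "D y = Suc (D (R y))" by (rule depth_pos[OF y])
  show ?thesis
  proof (cases "D y \<le> D (R (- a))")
    case True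
    have v: "root_class (- a) \<in> span \<Delta>" "y \<in> span \<Delta>"
      using a y root_class_root neg_almost_pos root_span pos_root by blast+
    have "euler (root_class (R y)) (root_class (R (- a))) = - ((a \<bullet> a) * rep y a)"
      using euler_serre[OF v(2,1)] euler_minus_right[OF v(1)] euler_neg_simple[OF a v(2)]
      by (simp add: root_class_R_pos[OF y] R_neg(2)[OF a])
    then show ?thesis
      using True dy ap compat_neg_pos[OF a y] root_nonzero[OF simple_root[OF a]]
      by (simp add: compat_def)
  next
    case False
    then have o: "a \<in> P" "y \<in> N" "D y = Suc (D (R (- a)))" using depth_overshoot[OF y a] by auto
    then have "a \<noteq> y" "y \<in> \<Delta>" using P_Int_N N_subset by auto
    then have "(- a, y) \<in> compat" using compat_neg_pos[OF a y] rep_simple[of y a] by simp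
    moreover have "R (- a) \<noteq> R y"
    proof
      assume "R (- a) = R y"
      then have "- a = y"
        using inj_onD[OF R_inj] a y neg_almost_pos pos_almost_pos by blast
      then show False using y neg_not_pos[OF a] by simp
    qed
    then have "(R (- a), R y) \<in> compat" using o(3) dy ap by (simp add: compat_def)
    ultimately show ?thesis by simp
  qed
qed

text \<open>
  Different negative simple roots are compatible, so their rotations have to be. If these differ in
  depth, then the deeper one comes from \<open>N\<close>, and the value of the Euler form is the coefficient of one
  simple root in another one.
\<close>

lemma compat_R_neg_neg:
  assumes a: "a \<in> \<Delta>" and b: "b \<in> \<Delta>"
  shows "(- a, - b) \<in> compat \<longleftrightarrow> (R (- a), R (- b)) \<in> compat"
proof -
  have ap: "R (- c) \<in> almost_pos" if "c \<in> \<Delta>" for c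
    using that by (simp add: R_almost_pos neg_almost_pos)
  have less: "(R (- c), R (- d)) \<in> compat"
    if c: "c \<in> \<Delta>" and d: "d \<in> \<Delta>" and lt: "D (R (- c)) < D (R (- d))" for c d
  proof -
    have cd: "c \<in> P" "d \<in> N" using return_times[OF c d lt] by auto
    then have "c \<noteq> d" using P_Int_N by auto
    have v: "root_class (- c) \<in> span \<Delta>" "root_class (- d) \<in> span \<Delta>"
      using c d root_class_root neg_almost_pos root_span by blast+
    have "euler (root_class (R (- c))) (root_class (R (- d))) = euler (root_class (- c)) (root_class (- d))"
      by (simp add: R_neg(2) c d euler_minus_left euler_minus_right v)
    also have "\<dots> = 0"
      using euler_neg_simple[OF c v(2)] \<open>c \<noteq> d\<close>
      by (simp add: root_class_neg_N[OF cd(2)] rep_minus span_base d rep_simple)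
    finally show ?thesis using lt ap c d by (simp add: compat_def)
  qed
  consider "D (R (- a)) = D (R (- b))" | "D (R (- a)) < D (R (- b))" | "D (R (- b)) < D (R (- a))"
    by linarith
  then show ?thesis
  proof cases
    case 1
    have "R (- a) = R (- b) \<longleftrightarrow> a = b"
      using inj_onD[OF R_inj _ neg_almost_pos[OF a] neg_almost_pos[OF b]] by auto
    then show ?thesis using 1 ap a b compat_neg_neg[OF a b] by (simp add: compat_def)
  next
    case 2
    then show ?thesis using less[OF a b] compat_neg_neg[OF a b] by auto
  next
    case 3
    then show ?thesis using less[OF b a] compat_neg_neg[OF a b] compat_sym by auto
  qed
qed

lemma compat_R_pos_pos:
  assumes x: "x \<in> pos" and y: "y \<in> pos"
  shows "(x, y) \<in> compat \<longleftrightarrow> (R x, R y) \<in> compat"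
proof -
  have "R x = R y \<longleftrightarrow> x = y"
    using inj_onD[OF R_inj _ pos_almost_pos[OF x] pos_almost_pos[OF y]] by auto
  then show ?thesis
    using x y
    by (simp add: compat_def pos_almost_pos R_almost_pos depth_pos root_class_R_pos root_class_pos euler_cox pos_root)
qed

lemma compat_R:
  assumes x: "x \<in> almost_pos" and y: "y \<in> almost_pos"
  shows "(x, y) \<in> compat \<longleftrightarrow> (R x, R y) \<in> compat"
  using x
proof (cases rule: almost_pos_cases)
  case 1
  from y show ?thesis
  proof (cases rule: almost_pos_cases)
    case 1
    then show ?thesis using \<open>x \<in> pos\<close> compat_R_pos_pos by blast
  next
    case (2 b)
    then show ?thesis
      using compat_R_neg_pos[OF 2(1) \<open>x \<in> pos\<close>] compat_sym[of x y] compat_sym[of "R x" "R y"] by simp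
  qed
next
  case (2 a)
  from y show ?thesis
  proof (cases rule: almost_pos_cases)
    case 1
    then show ?thesis using 2 compat_R_neg_pos by blast
  next
    case (2 b)
    then show ?thesis using \<open>x = - a\<close> \<open>a \<in> \<Delta>\<close> compat_R_neg_neg by blast
  qed
qed

lemma is_compatibility_compat: "is_compatibility \<Phi> \<Delta> P N compat"
  unfolding is_compatibility_def
proof (intro conjI ballI)
  show "compat \<subseteq> almost_pos \<times> almost_pos" by (auto simp: compat_def)
  show "sym compat" using compat_sym by (auto intro: symI)
  fix x y assume "x \<in> almost_pos" "y \<in> almost_pos"
  then show "(x, y) \<in> compat \<longleftrightarrow> (R x, R y) \<in> compat" by (rule compat_R)
next
  fix a b assume "a \<in> \<Delta>" "b \<in> pos"
  then show "(- a, b) \<in> compat \<longleftrightarrow> \<not> involves \<Delta> b a" using compat_neg_pos by (simp add: involves_def)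
next
  fix a b assume "a \<in> \<Delta>" "b \<in> \<Delta>"
  then show "(- a, - b) \<in> compat \<longleftrightarrow> a \<noteq> b" by (rule compat_neg_neg)
qed

text \<open>
  Rotating a pair of positive roots reduces the depth of the first one until one of the two roots is a
  negative simple root.
\<close>

lemma is_compatibility_unique:
  assumes C: "is_compatibility \<Phi> \<Delta> P N C" "is_compatibility \<Phi> \<Delta> P N C'"
  shows "C = C'"
proof -
  have "(x, y) \<in> C \<longleftrightarrow> (x, y) \<in> C'" if "x \<in> almost_pos" "y \<in> almost_pos" for x y
    using that
  proof (induction "D x" arbitrary: x y rule: less_induct)
    case less
    have symC: "(u, v) \<in> C \<longleftrightarrow> (v, u) \<in> C" "(u, v) \<in> C' \<longleftrightarrow> (v, u) \<in> C'" for u v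
      using C by (auto simp: is_compatibility_def sym_def)
    have neg: "(- a, w) \<in> C \<longleftrightarrow> (- a, w) \<in> C'" if "a \<in> \<Delta>" "w \<in> almost_pos" for a w
      using that(2) by (cases rule: almost_pos_cases) (use C that(1) in \<open>auto simp: is_compatibility_def\<close>)
    from less.prems(1) show ?case
    proof (cases rule: almost_pos_cases)
      case 1
      from less.prems(2) show ?thesis
      proof (cases rule: almost_pos_cases)
        case 1
        have "D (R x) < D x" using depth_pos[OF \<open>x \<in> pos\<close>] by simp
        then have "(R x, R y) \<in> C \<longleftrightarrow> (R x, R y) \<in> C'"
          using less.hyps R_almost_pos less.prems by blast
        moreover have "(x, y) \<in> C \<longleftrightarrow> (R x, R y) \<in> C" "(x, y) \<in> C' \<longleftrightarrow> (R x, R y) \<in> C'"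
          using C less.prems by (auto simp: is_compatibility_def)
        ultimately show ?thesis by simp
      next
        case (2 b)
        then show ?thesis using neg[OF 2(1) less.prems(1)] symC[of x y] by simp
      qed
    next
      case (2 a)
      then show ?thesis using neg less.prems(2) by blast
    qed
  qed
  moreover have "C \<subseteq> almost_pos \<times> almost_pos" "C' \<subseteq> almost_pos \<times> almost_pos"
    using C by (auto simp: is_compatibility_def)
  ultimately show ?thesis by auto
qed

lemma compatibility_eq: "compatibility \<Phi> \<Delta> P N = compat"
  unfolding compatibility_def
  using is_compatibility_compat is_compatibility_unique by (intro the_equality) auto

section \<open>Colored roots\<close>

abbreviation colored_compat where "colored_compat \<equiv> colored_compatible \<Phi> \<Delta> P N"

lemma colored_compat_iff:
  "colored_compat (a, k) (b, l) \<longleftrightarrow>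
     k > l \<and> D a \<le> D b \<and> (R a, b) \<in> compat \<or> k < l \<and> D a \<ge> D b \<and> (a, R b) \<in> compat \<or>
     k > l \<and> D a > D b \<and> (a, b) \<in> compat \<or> k < l \<and> D a < D b \<and> (a, b) \<in> compat \<or>
     k = l \<and> (a, b) \<in> compat"
  by (simp add: colored_compatible_def compatibility_eq Let_def)

lemma colored_compat_sym: "colored_compat x y \<longleftrightarrow> colored_compat y x"
  by (cases x; cases y) (auto simp: colored_compat_iff compat_sym)

lemma compat_neg:
  assumes a: "a \<in> \<Delta>" and b: "b \<in> almost_pos"
  shows "(- a, b) \<in> compat \<longleftrightarrow> \<not> involves \<Delta> b a"
  using b
proof (cases rule: almost_pos_cases)
  case 1
  then show ?thesis using compat_neg_pos a by (simp add: involves_def)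
next
  case (2 c)
  then show ?thesis
    using compat_neg_neg[OF a 2(1)] by (auto simp: involves_def rep_minus span_base rep_simple)
qed

text \<open>
  One root changes color while the other one is rotated. For positive \<open>b\<close> the comparison of depths
  shifts by exactly the one unit that turns a weak inequality into a strict one. For a negative
  \<open>b\<close> the cases are those of \<open>depth_overshoot\<close>; in the exceptional one \<open>a = R (- a)\<close>, so that
  \<open>a\<close> is compatible with \<open>R b\<close> because \<open>- a\<close> is compatible with \<open>b\<close>.
\<close>

lemma colored_compat_wrap_one:
  assumes a: "a \<in> pos" and b: "b \<in> pos \<and> k < l \<or> b \<in> uminus ` \<Delta> \<and> l = 1" and k: "1 \<le> k"
  shows "colored_compat (a, k) (b, l) \<longleftrightarrow> colored_compat (a, k + 1) (R b, 1)"
proof -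
  have ap: "a \<in> almost_pos" "b \<in> almost_pos"
    using a b by (auto simp: pos_almost_pos neg_almost_pos)
  note RR = compat_R[OF ap]
  from b show ?thesis
  proof
    assume "b \<in> pos \<and> k < l"
    then show ?thesis using depth_pos[of b] RR k by (auto simp: colored_compat_iff)
  next
    assume "b \<in> uminus ` \<Delta> \<and> l = 1"
    then obtain c where c: "c \<in> \<Delta>" "b = - c" "l = 1" by blast
    have "D b = 0" "0 < D a" using c depth_neg depth_pos[OF a] by simp_all
    then have lhs: "colored_compat (a, k) (b, l) \<longleftrightarrow> (a, b) \<in> compat"
      using k c by (auto simp: colored_compat_iff)
    show ?thesis
    proof (cases "D a \<le> D (R b)")
      case True
      then show ?thesis using lhs RR k by (simp add: colored_compat_iff)
    next
      case False
      then have o: "c \<in> P" "a \<in> N" using depth_overshoot[OF a c(1)] c by auto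
      then have ac: "a \<noteq> c" "a \<in> \<Delta>" using P_Int_N N_subset by auto
      have "(a, b) \<in> compat"
        using compat_neg_pos[OF c(1) a] ac compat_sym c by (simp add: rep_simple)
      moreover have "(a, R b) \<in> compat"
        using compat_R_neg_neg[OF ac(2) c(1)] compat_neg_neg[OF ac(2) c(1)] ac R_neg_N[OF o(2)] c
        by simp
      ultimately show ?thesis using lhs False k by (simp add: colored_compat_iff)
    qed
  qed
qed

lemma colored_compat_wrap_both:
  assumes a: "a \<in> pos \<and> k = m \<or> a \<in> uminus ` \<Delta> \<and> k = 1"
    and b: "b \<in> pos \<and> l = m \<or> b \<in> uminus ` \<Delta> \<and> l = 1" and m: "1 \<le> m"
  shows "colored_compat (a, k) (b, l) \<longleftrightarrow> colored_compat (R a, 1) (R b, 1)"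
proof -
  have ap: "a \<in> almost_pos" "b \<in> almost_pos"
    using a b by (auto simp: pos_almost_pos neg_almost_pos)
  have d: "D c = 0" if "c \<in> uminus ` \<Delta>" for c using that depth_neg by auto
  have "colored_compat (a, k) (b, l) \<longleftrightarrow> (a, b) \<in> compat"
    using a b m d depth_pos[of a] depth_pos[of b] by (auto simp: colored_compat_iff)
  then show ?thesis using compat_R[OF ap] by (simp add: colored_compat_iff)
qed

lemma colored_rootE:
  assumes "x \<in> colored_roots \<Phi> \<Delta> m"
  obtains a k where "x = (a, k)" "a \<in> pos" "1 \<le> k" "k < m" "colored_rot \<Phi> \<Delta> P N m x = (a, k + 1)"
  | a k where "x = (a, k)" "a \<in> pos \<and> k = m \<and> 1 \<le> m \<or> a \<in> uminus ` \<Delta> \<and> k = 1"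
      "colored_rot \<Phi> \<Delta> P N m x = (R a, 1)"
proof -
  obtain a k where x: "x = (a, k)" by (cases x)
  then have "a \<in> pos \<and> 1 \<le> k \<and> k \<le> m \<or> a \<in> uminus ` \<Delta> \<and> k = 1"
    using assms by (auto simp: colored_roots_def)
  then consider "a \<in> pos" "1 \<le> k" "k < m" | "a \<in> pos \<and> k = m \<and> 1 \<le> m \<or> a \<in> uminus ` \<Delta> \<and> k = 1"
    by linarith
  then show thesis
  proof cases
    case 1
    then show thesis using that(1)[OF x] by (simp add: x colored_rot_def)
  next
    case 2
    then have "colored_rot \<Phi> \<Delta> P N m x = (R a, 1)"
      using pos_not_neg_simple by (auto simp: x colored_rot_def)
    then show thesis using that(2)[OF x 2] by blast
  qed
qed

lemma colored_rot_root:
  assumes "x \<in> colored_roots \<Phi> \<Delta> m" "1 \<le> m"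
  shows "colored_rot \<Phi> \<Delta> P N m x \<in> colored_roots \<Phi> \<Delta> m"
  using assms(1)
proof (cases rule: colored_rootE)
  case (1 a k)
  then show ?thesis by (simp add: colored_roots_def)
next
  case (2 a k)
  then have "R a \<in> almost_pos" by (auto simp: R_almost_pos pos_almost_pos neg_almost_pos)
  then show ?thesis using 2 assms(2) by (auto simp: colored_roots_def almost_positive_roots_def)
qed

lemma colored_compat_rot:
  assumes x: "x \<in> colored_roots \<Phi> \<Delta> m" and y: "y \<in> colored_roots \<Phi> \<Delta> m"
  shows "colored_compat x y \<longleftrightarrow>
    colored_compat (colored_rot \<Phi> \<Delta> P N m x) (colored_rot \<Phi> \<Delta> P N m y)"
  using x
proof (cases rule: colored_rootE)
  case x1: (1 a k)
  from y show ?thesis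
  proof (cases rule: colored_rootE)
    case (1 b l)
    with x1 show ?thesis by (simp add: colored_compat_iff)
  next
    case (2 b l)
    with x1 show ?thesis using colored_compat_wrap_one[of a b k l] by auto
  qed
next
  case x2: (2 a k)
  from y show ?thesis
  proof (cases rule: colored_rootE)
    case (1 b l)
    with x2 show ?thesis
      using colored_compat_wrap_one[of b a l k] colored_compat_sym by auto
  next
    case (2 b l)
    \<comment> \<open>The only colored roots for \<open>m = 0\<close> are negative, and then the number of colors is immaterial.\<close>
    have m0: "colored_compat (c, 1) (d, 1) \<longleftrightarrow> colored_compat (R c, 1) (R d, 1)"
      if "c \<in> uminus ` \<Delta>" "d \<in> uminus ` \<Delta>" for c d
      using colored_compat_wrap_both[of c 1 1 d 1] that by simp
    from 2 x2 show ?thesis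
      using colored_compat_wrap_both[of a k m b l] m0[of a b] by auto
  qed
qed

lemma colored_compat_neg:
  assumes a: "a \<in> \<Delta>" and b: "(b, l) \<in> colored_roots \<Phi> \<Delta> m"
  shows "colored_compat (- a, 1) (b, l) \<longleftrightarrow> \<not> involves \<Delta> b a"
proof -
  have ap: "b \<in> almost_pos" using b by (auto simp: colored_roots_def almost_positive_roots_def)
  have "l = 1 \<or> 1 < l \<and> D (- a) < D b"
    using b depth_neg[OF a] depth_pos[of b] by (auto simp: colored_roots_def)
  then have "colored_compat (- a, 1) (b, l) \<longleftrightarrow> (- a, b) \<in> compat"
    by (auto simp: colored_compat_iff)
  then show ?thesis using compat_neg[OF a ap] by simp
qed

text \<open>
  The colored rotation of \<open>x\<close> first uses up the colors and then lowers the depth, so \<open>x\<close> reaches a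
  negative simple root. The measure counts these steps.
\<close>

lemma colored_relation_unique:
  assumes rot: "\<And>x y. x \<in> colored_roots \<Phi> \<Delta> m \<Longrightarrow> y \<in> colored_roots \<Phi> \<Delta> m \<Longrightarrow>
      Q x y \<longleftrightarrow> Q (colored_rot \<Phi> \<Delta> P N m x) (colored_rot \<Phi> \<Delta> P N m y)"
    and neg: "\<And>a b l. a \<in> \<Delta> \<Longrightarrow> (b, l) \<in> colored_roots \<Phi> \<Delta> m \<Longrightarrow>
      Q (- a, 1) (b, l) \<longleftrightarrow> \<not> involves \<Delta> b a"
    and x: "x \<in> colored_roots \<Phi> \<Delta> m" and y: "y \<in> colored_roots \<Phi> \<Delta> m"
  shows "Q x y \<longleftrightarrow> colored_compat x y"
  using x y
proof (induction "D (fst x) * (m + 1) + (m - snd x)" arbitrary: x y rule: less_induct)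
  case less
  let ?r = "colored_rot \<Phi> \<Delta> P N m"
  show ?case
  proof (cases "fst x \<in> pos")
    case True
    have m: "1 \<le> m"
      using less.prems(1) True neg_not_pos by (auto simp: colored_roots_def)
    from less.prems(1) have "D (fst (?r x)) * (m + 1) + (m - snd (?r x)) < D (fst x) * (m + 1) + (m - snd x)"
    proof (cases rule: colored_rootE)
      case (1 a k)
      then show ?thesis by simp
    next
      case (2 a k)
      then have "D a = Suc (D (R a))" using depth_pos True by simp
      then show ?thesis using 2 m by simp
    qed
    from less.hyps[OF this colored_rot_root[OF less.prems(1) m] colored_rot_root[OF less.prems(2) m]]
    show ?thesis using rot[OF less.prems] colored_compat_rot[OF less.prems] by simp
  next
    case False
    then obtain a where a: "a \<in> \<Delta>" "x = (- a, 1)"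
      using less.prems(1) by (auto simp: colored_roots_def)
    obtain b l where "y = (b, l)" by (cases y)
    then show ?thesis using neg[OF a(1)] colored_compat_neg[OF a(1)] less.prems(2) a(2) by simp
  qed
qed

end

theorem theorem3p4:
  fixes \<Phi> \<Delta> P N :: "'a::euclidean_space set" and m :: nat
  assumes "root_system \<Phi>" and "irreducible_roots \<Phi>"
    and "simple_system \<Phi> \<Delta>" and "bipartition \<Delta> P N"
  shows
    "(\<forall>x\<in>colored_roots \<Phi> \<Delta> m. \<forall>y\<in>colored_roots \<Phi> \<Delta> m.
        colored_compatible \<Phi> \<Delta> P N x y \<longleftrightarrow>
        colored_compatible \<Phi> \<Delta> P N (colored_rot \<Phi> \<Delta> P N m x) (colored_rot \<Phi> \<Delta> P N m y)) \<and>
     (\<forall>a\<in>\<Delta>. \<forall>(b, l)\<in>colored_roots \<Phi> \<Delta> m.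
        colored_compatible \<Phi> \<Delta> P N (- a, 1) (b, l) \<longleftrightarrow> \<not> involves \<Delta> b a) \<and>
     (\<forall>Q :: 'a \<times> nat \<Rightarrow> 'a \<times> nat \<Rightarrow> bool.
        (\<forall>x\<in>colored_roots \<Phi> \<Delta> m. \<forall>y\<in>colored_roots \<Phi> \<Delta> m.
           Q x y \<longleftrightarrow> Q (colored_rot \<Phi> \<Delta> P N m x) (colored_rot \<Phi> \<Delta> P N m y)) \<and>
        (\<forall>a\<in>\<Delta>. \<forall>(b, l)\<in>colored_roots \<Phi> \<Delta> m. Q (- a, 1) (b, l) \<longleftrightarrow> \<not> involves \<Delta> b a) \<longrightarrow>
        (\<forall>x\<in>colored_roots \<Phi> \<Delta> m. \<forall>y\<in>colored_roots \<Phi> \<Delta> m.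
           Q x y \<longleftrightarrow> colored_compatible \<Phi> \<Delta> P N x y))"
proof -
  interpret bipartite_roots \<Phi> \<Delta> P N by unfold_locales (rule assms)+
  show ?thesis
  proof (intro conjI allI impI ballI)
    fix Q :: "'a \<times> nat \<Rightarrow> 'a \<times> nat \<Rightarrow> bool" and x y
    assume Q: "(\<forall>x\<in>colored_roots \<Phi> \<Delta> m. \<forall>y\<in>colored_roots \<Phi> \<Delta> m.
           Q x y \<longleftrightarrow> Q (colored_rot \<Phi> \<Delta> P N m x) (colored_rot \<Phi> \<Delta> P N m y)) \<and>
        (\<forall>a\<in>\<Delta>. \<forall>(b, l)\<in>colored_roots \<Phi> \<Delta> m. Q (- a, 1) (b, l) \<longleftrightarrow> \<not> involves \<Delta> b a)"
      and xy: "x \<in> colored_roots \<Phi> \<Delta> m" "y \<in> colored_roots \<Phi> \<Delta> m"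
    show "Q x y \<longleftrightarrow> colored_compatible \<Phi> \<Delta> P N x y"
      by (rule colored_relation_unique[OF _ _ xy]) (use Q in blast)+
  qed (use colored_compat_rot colored_compat_neg in auto)
qed

end
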